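(* Let $\mathbb{P}$ be a translation-invariant Gibbs random field on $\mathbb{Z}^d$, $d\ge 2$, which is non-uniformly exponentially $\varphi$-mixing. Then there exist strictly positive constants $C,c,\rho,\Lambda_1,\Lambda_2$ with $\Lambda_1\le\Lambda_2$ such that for any $n$ and any $n$-pattern $A_n$ there exists $\lambda_{A_n}\in[\Lambda_1,\Lambda_2]$ such that $$\left|\ \mathbb{P}\left\{\mathbf{t}_{A_n}>\left(\frac{t}{\lambda_{A_n}\,\mathbb{P}(\mathcal{C}(A_n))}\right)^{1/d}\right\}-e^{-t}\ \right|\le C\ \mathbb{P}(\mathcal{C}(A_n))^{\rho}\ e^{-ct}$$ for any $t>0$.
   Context: Setting. $\mathcal{A}$ is a finite set, $\Omega=\mathcal{A}^{\mathbb{Z}^d}$ with the product topology and its Borel sigma-field, $\mathcal{S}$ is the set of (nonempty) finite subsets of $\mathbb{Z}^d$, $|\mathbf{x}|=\sum_i|x_i|$ for $\mathbf{x}\in\mathbb{Z}^d$, $d(A,B)=\min\{|\mathbf{x}-\mathbf{y}|:\mathbf{x}\in A,\mathbf{y}\in B\}$ for $A,B\in\mathcal{S}$. $\sigma_V$ denotes the restriction of $\sigma\in\Omega$ to $V$, $\Omega_V=\mathcal{A}^V$, $\mathcal{F}_V$ is the sigma-field generated by the coordinates $\sigma(\mathbf{x})$, $\mathbf{x}\in V$, and $(\tau_{\mathbf{x}}\sigma)(\mathbf{y})=\sigma(\mathbf{x}+\mathbf{y})$. Patterns. $C_n=[0,n]^d\cap\mathbb{Z}^d$; an $n$-pattern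 is an element $A_n\in\Omega_{C_n}$; its cylinder is $\mathcal{C}(A_n)=\{\sigma\in\Omega:\sigma_{C_n}=A_n\}$. The first occurrence $\mathbf{t}_{A_n}(\sigma)$ is the minimal $k\in\mathbb{N}$ such that there is $\mathbf{x}\in\mathbb{Z}_+^d$ (nonnegative coordinates) with $|\mathbf{x}|>0$, $x_i\le k$ for all $i$, and $(\tau_{\mathbf{x}}\sigma)_{C_n}=A_n$; $\mathbf{t}_{A_n}(\sigma)=\infty$ if no such $\mathbf{x}$ exists. Gibbs fields. A translation-invariant interaction is $U:\mathcal{S}\times\Omega\to\mathbb{R}$ such that $U(A,\sigma)$ depends only on $\sigma_A$, $U(A+\mathbf{x},\tau_{-\mathbf{x}}\sigma)=U(A,\sigma)$, and $\sum_{A\ni 0}\sup_\sigma|U(A,\sigma)|<\infty$. Put $H^\zeta_\Lambda(\sigma)=\sum_{A\cap\Lambda\ne\emptyset}U(A,\sigma_\Lambda\zeta_{\Lambda^c})$. A translation-invariant Gibbs random field (with interaction $U$) is a translation-invariant probability measure $\mathbb{P}$ on $\Omega$ such that for every $\Lambda\in\mathcal{S}$ the conditional distribution of $\sigma_\Lambda$ given $\sigma_{\Lambda^c}=\zeta_{\Lambda^c}$ is, for $\mathbb{P}$-a.e. $\zeta$, proportional to $e^{-H^\zeta_\Lambda(\sigma)}$. Mixing. For $m>0$, $\varphi(m)=\sup\frac{1}{|A_1|}\left|\mathbb{P}(E_{A_1}\mid E_{A_2})-\mathbb{P}(E_{A_1})\right|$, the supremum over finite $A_1,A_2\subset\mathbb{Z}^d$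 with $d(A_1,A_2)\ge m$ and events $E_{A_i}\in\mathcal{F}_{A_i}$ with $\mathbb{P}(E_{A_2})>0$. $\mathbb{P}$ is non-uniformly exponentially $\varphi$-mixing if there are constants $C_1,C_2>0$ with $\varphi(m)\le C_1e^{-C_2m}$ for all $m>0$. *)

theory Defs
  imports "HOL-Probability.Probability"
begin

text \<open>
  The lattice is the additive group \<^typ>\<open>int ^ 'd\<close>, of dimension \<open>CARD('d)\<close>; the alphabet is a
  finite type \<^typ>\<open>'a\<close>. A pattern on a set \<open>V\<close> of sites is a function on all sites that is
  \<^const>\<open>undefined\<close> outside \<open>V\<close>, so that it can be compared with \<open>restrict \<sigma> V\<close>.
\<close>

type_synonym 'd site = "int ^ 'd"
type_synonym ('d, 'a) config = "'d site \<Rightarrow> 'a"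

definition l1 :: "'d::finite site \<Rightarrow> int" where
  "l1 x = (\<Sum>i\<in>UNIV. \<bar>x $ i\<bar>)"

definition finite_volumes :: "'d::finite site set set" where
  "finite_volumes = {A. finite A \<and> A \<noteq> {}}"

definition set_distance :: "'d::finite site set \<Rightarrow> 'd site set \<Rightarrow> int" where
  "set_distance A B = Min {l1 (x - y) | x y. x \<in> A \<and> y \<in> B}"

definition translate :: "'d::finite site \<Rightarrow> ('d, 'a) config \<Rightarrow> ('d, 'a) config" where
  "translate x \<sigma> = (\<lambda>y. \<sigma> (x + y))"

definition config_space :: "('d::finite, 'a::finite) config measure" where
  "config_space = sigma UNIV {G. openin (product_topology (\<lambda>_. discrete_topology UNIV) UNIV) G}"

definition coord_algebra :: "'d::finite site set \<Rightarrow> ('d, 'a::finite) config measure" where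
  "coord_algebra V = sigma UNIV {(\<lambda>\<sigma>. \<sigma> x) -` B | x B. x \<in> V}"

definition patterns :: "'d::finite site set \<Rightarrow> ('d, 'a::finite) config set" where
  "patterns V = V \<rightarrow>\<^sub>E UNIV"

definition cube :: "nat \<Rightarrow> 'd::finite site set" where
  "cube n = {x. \<forall>i. 0 \<le> x $ i \<and> x $ i \<le> int n}"

definition cylinder :: "'d::finite site set \<Rightarrow> ('d, 'a::finite) config \<Rightarrow> ('d, 'a) config set" where
  "cylinder V \<eta> = {\<sigma>. restrict \<sigma> V = \<eta>}"

definition occurs_within ::
    "nat \<Rightarrow> ('d::finite, 'a::finite) config \<Rightarrow> ('d, 'a) config \<Rightarrow> nat \<Rightarrow> bool" where
  "occurs_within n A \<sigma> k \<longleftrightarrow>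
     (\<exists>x. (\<forall>i. 0 \<le> x $ i) \<and> l1 x > 0 \<and> (\<forall>i. x $ i \<le> int k) \<and>
          restrict (translate x \<sigma>) (cube n) = A)"

definition first_occurrence ::
    "nat \<Rightarrow> ('d::finite, 'a::finite) config \<Rightarrow> ('d, 'a) config \<Rightarrow> enat" where
  "first_occurrence n A \<sigma> =
     (if \<exists>k. occurs_within n A \<sigma> k then enat (LEAST k. occurs_within n A \<sigma> k) else \<infinity>)"

definition ti_random_field :: "('d::finite, 'a::finite) config measure \<Rightarrow> bool" where
  "ti_random_field P \<longleftrightarrow>
     prob_space P \<and> sets P = sets config_space \<and> (\<forall>x. distr P config_space (translate x) = P)"

text \<open>
  In the summability condition each supremum is over a bounded set, because \<open>U A\<close> depends only on
  finitely many coordinates with values in a finite alphabet. Together with translation invariance it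
  makes the series in the Hamiltonian below absolutely convergent.
\<close>

definition ti_interaction ::
    "('d::finite site set \<Rightarrow> ('d, 'a::finite) config \<Rightarrow> real) \<Rightarrow> bool" where
  "ti_interaction U \<longleftrightarrow>
     (\<forall>A\<in>finite_volumes. \<forall>\<sigma> \<sigma>'. (\<forall>x\<in>A. \<sigma> x = \<sigma>' x) \<longrightarrow> U A \<sigma> = U A \<sigma>') \<and>
     (\<forall>A\<in>finite_volumes. \<forall>x \<sigma>. U ((\<lambda>y. y + x) ` A) (translate (- x) \<sigma>) = U A \<sigma>) \<and>
     (\<lambda>A. SUP \<sigma>. \<bar>U A \<sigma>\<bar>) summable_on {A \<in> finite_volumes. 0 \<in> A}"

definition hamiltonian ::
    "('d::finite site set \<Rightarrow> ('d, 'a::finite) config \<Rightarrow> real) \<Rightarrow> 'd site set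
     \<Rightarrow> ('d, 'a) config \<Rightarrow> ('d, 'a) config \<Rightarrow> real" where
  "hamiltonian U \<Lambda> \<zeta> \<sigma> =
     (\<Sum>\<^sub>\<infinity>A\<in>{A \<in> finite_volumes. A \<inter> \<Lambda> \<noteq> {}}. U A (override_on \<zeta> \<sigma> \<Lambda>))"

text \<open>
  Being a probability distribution on \<open>patterns \<Lambda>\<close> proportional to the Boltzmann weights determines
  the normalising constant, the partition function in the denominator.
\<close>

definition ti_gibbs_field ::
    "('d::finite site set \<Rightarrow> ('d, 'a::finite) config \<Rightarrow> real) \<Rightarrow> ('d, 'a) config measure \<Rightarrow> bool" where
  "ti_gibbs_field U P \<longleftrightarrow>
     ti_random_field P \<and>
     (\<forall>\<Lambda>\<in>finite_volumes. \<forall>\<eta>\<in>patterns \<Lambda>. AE \<zeta> in P.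
        real_cond_exp P (coord_algebra (- \<Lambda>)) (indicator (cylinder \<Lambda> \<eta>)) \<zeta> =
        exp (- hamiltonian U \<Lambda> \<zeta> \<eta>) / (\<Sum>\<eta>'\<in>patterns \<Lambda>. exp (- hamiltonian U \<Lambda> \<zeta> \<eta>')))"

text \<open>The set is nonempty and, for a probability measure, bounded above by 1.\<close>

definition phi_mixing :: "('d::finite, 'a::finite) config measure \<Rightarrow> real \<Rightarrow> real" where
  "phi_mixing P m =
     Sup {1 / real (card A1) * \<bar>\<P>(\<sigma> in P. \<sigma> \<in> E1 \<bar> \<sigma> \<in> E2) - measure P E1\<bar> | A1 A2 E1 E2.
            A1 \<in> finite_volumes \<and> A2 \<in> finite_volumes \<and> real_of_int (set_distance A1 A2) \<ge> m \<and>
            E1 \<in> sets (coord_algebra A1) \<and> E2 \<in> sets (coord_algebra A2) \<and> measure P E2 > 0}"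

definition exp_phi_mixing :: "('d::finite, 'a::finite) config measure \<Rightarrow> bool" where
  "exp_phi_mixing P \<longleftrightarrow>
     (\<exists>C1>0. \<exists>C2>0. \<forall>m>0. phi_mixing P m \<le> C1 * exp (- C2 * m))"

lemma sets_config_space_eq_PiM:
  "sets (config_space :: ('d::finite, 'a::finite) config measure) =
   sets (PiM UNIV (\<lambda>_. count_space UNIV))"
proof -
  let ?T = "product_topology (\<lambda>_. discrete_topology UNIV) UNIV :: ('d, 'a) config topology"
  let ?M = "PiM UNIV (\<lambda>_. count_space UNIV) :: ('d, 'a) config measure"
  have cyl: "{\<sigma>. \<sigma> i \<in> B} \<in> sets ?M" for i :: "'d site" and B :: "'a set"
    using measurable_sets[OF measurable_component_singleton
        [of i UNIV "\<lambda>_. count_space UNIV"], of B]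
    by (simp add: space_PiM vimage_def)
  have 1: "G \<in> sets ?M" if G: "openin ?T G" for G
  proof -
    define cy where "cy = (\<lambda>p :: ('d site \<times> 'a) list. {\<sigma> :: ('d, 'a) config. \<forall>(i, a)\<in>set p. \<sigma> i = a})"
    have cy_sets: "cy p \<in> sets ?M" for p
    proof (induction p)
      case Nil
      have "UNIV \<in> sets ?M"
        using sets.top[of ?M] by (simp add: space_PiM)
      then show ?case by (simp add: cy_def)
    next
      case (Cons ia p)
      obtain i a where ia: "ia = (i, a)" by (cases ia)
      have "cy (ia # p) = {\<sigma>. \<sigma> i \<in> {a}} \<inter> cy p"
        by (auto simp: cy_def ia)
      then show ?case using sets.Int[OF cyl Cons.IH] by metis
    qed
    have "\<exists>p. \<sigma> \<in> cy p \<and> cy p \<subseteq> G" if s: "\<sigma> \<in> G" for \<sigma>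
    proof -
      obtain V where V: "finite {i. V i \<noteq> UNIV}" "\<sigma> \<in> Pi\<^sub>E UNIV V" "Pi\<^sub>E UNIV V \<subseteq> G"
        using G s by (simp add: openin_product_topology_alt) metis
      obtain xs where xs: "set xs = {i. V i \<noteq> UNIV}"
        using V(1) finite_list by blast
      have "\<sigma> \<in> cy (map (\<lambda>i. (i, \<sigma> i)) xs)" by (auto simp: cy_def)
      moreover have "cy (map (\<lambda>i. (i, \<sigma> i)) xs) \<subseteq> Pi\<^sub>E UNIV V"
      proof
        fix \<tau> assume t: "\<tau> \<in> cy (map (\<lambda>i. (i, \<sigma> i)) xs)"
        have "\<tau> i \<in> V i" for i
        proof (cases "i \<in> set xs")
          case True
          then have "\<tau> i = \<sigma> i" using t by (auto simp: cy_def)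
          then show ?thesis using V(2) by auto
        qed (use xs in auto)
        then show "\<tau> \<in> Pi\<^sub>E UNIV V" by auto
      qed
      ultimately show ?thesis using V(3) by blast
    qed
    then have "G = (\<Union>p\<in>{p. cy p \<subseteq> G}. cy p)" by blast
    also have "\<dots> \<in> sets ?M"
      by (rule sets.countable_UN') (use cy_sets in auto)
    finally show ?thesis .
  qed
  have 2: "{f \<in> (UNIV :: 'd site set) \<rightarrow>\<^sub>E UNIV. f i \<in> B} \<in> {G. openin ?T G}"
    for i and B :: "'a set"
    using openin_continuous_map_preimage[OF continuous_map_product_projection
        [of i UNIV "\<lambda>_. discrete_topology UNIV"], of B]
    by simp
  show ?thesis
  proof (rule antisym)
    show "sets (config_space :: ('d, 'a) config measure) \<subseteq> sets ?M"
      using sets.sigma_sets_subset[of "{G. openin ?T G}" ?M] 1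
      by (auto simp: config_space_def space_PiM)
    show "sets ?M \<subseteq> sets (config_space :: ('d, 'a) config measure)"
      unfolding sets_PiM_single config_space_def using 2
      by (auto intro!: sigma_sets_mono')
  qed
qed

lemma subalgebra_coord_algebra:
  fixes P :: "('d::finite, 'a::finite) config measure"
  assumes "sets P = sets config_space"
  shows "subalgebra P (coord_algebra V)"
proof -
  let ?M = "PiM UNIV (\<lambda>_. count_space UNIV) :: ('d, 'a) config measure"
  have P: "sets P = sets ?M"
    using assms by (simp add: sets_config_space_eq_PiM)
  then have sp: "space P = UNIV"
    using sets_eq_imp_space_eq[OF P] by (simp add: space_PiM)
  have "(\<lambda>\<sigma>. \<sigma> x) -` B \<in> sets ?M" for x :: "'d site" and B :: "'a set"
    using measurable_sets[OF measurable_component_singleton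
        [of x UNIV "\<lambda>_. count_space UNIV"], of B]
    by (simp add: space_PiM)
  then have "sigma_sets UNIV {(\<lambda>\<sigma>. \<sigma> x) -` B | x B. x \<in> V} \<subseteq> sets P"
    using sets.sigma_sets_subset[of "{(\<lambda>\<sigma>. \<sigma> x) -` B | x B. x \<in> V}" P] P sp by auto
  then show ?thesis
    by (simp add: subalgebra_def coord_algebra_def sp)
qed

end

theory Submission
  imports Defs
begin

text \<open>
  Write \<open>q V\<close> for the probability that the pattern occurs at no site of \<open>V\<close>, and \<open>p\<close> for the
  probability of its cylinder. With \<open>L\<close> of order \<open>p powr (- 1 / (4 * d))\<close>, cut the lattice into
  boxes of side \<open>f = L\<^sup>2\<close>. The mixing condition bounds the error relative to the probability of the conditioning
  event; applied across a gap of width \<open>L\<close> around a box \<open>B\<close> it gives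
  \<open>\<bar>q (W \<union> B) - q W * q B\<bar> \<le> \<epsilon> * q W\<close> for a union \<open>W\<close> of other boxes. Occurrences inside the gap are
  removed by submodularity of \<open>q\<close>, after deleting from \<open>W\<close> the neighbours of \<open>B\<close>, which changes \<open>q W\<close>
  by a bounded factor only. Hence \<open>q\<close> of \<open>N\<close> boxes is \<open>q B ^ N\<close> up to relative errors that are powers
  of \<open>p\<close>, and \<open>lam = - ln (q B) / (f\<^sup>d * p)\<close> is the right normalisation. It is bounded below by the
  second moment method: finite energy of the Gibbs field and mixing show that occurrences cluster
  only boundedly. The finitely many patterns with \<open>p\<close> above a threshold are treated by mixing along a
  sparse sublattice, and a one-letter alphabet, where \<open>p = 1\<close> for every \<open>n\<close>, separately.
\<close>

section \<open>Boxes in the lattice\<close>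

text \<open>The volume factor in the mixing condition counts one of the two sets only. A single box
  can therefore be compared with an arbitrarily large union of boxes at a cost that depends on the
  box alone, and boxes are added one at a time. The error has to be relative to \<open>q W\<close>:
  the final bound carries exp (- c * t) for all t, while the number of boxes grows with t without
  limit, so additive errors would soon exceed the main term. The exponent of p comes from f = L^2. A
  box holds about L^(-2 d) occurrences on average, and the share of them in its rim of width L is of
  order L / f = 1 / L. The mixing error is exponentially small in L, because finite energy makes n
  at most a multiple of ln (1 / p), which is small against L. By the second moment bound -ln (q B)
  is of order f^d * p, so the relative error per box is of order 1 / L, that is p powr (1 / (4 *
  d)). Counting whole boxes in a cube costs no more. All constants are uniform in n and in the
  pattern.\<close>

lemma vec_box_eq: "{x :: 'b ^ 'd::finite. \<forall>i. x $ i \<in> S i} = vec_lambda ` PiE UNIV S"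
proof -
  have "x \<in> vec_lambda ` PiE UNIV S" if "\<forall>i. x $ i \<in> S i" for x :: "'b ^ 'd"
    using that by (intro image_eqI[of _ _ "vec_nth x"]) auto
  then show ?thesis by auto
qed

lemma inj_vec_lambda: "inj_on vec_lambda (X :: ('d::finite \<Rightarrow> 'b) set)"
  by (auto simp: inj_on_def vec_lambda_inject)

lemma finite_vec_box:
  "(\<And>i. finite (S i)) \<Longrightarrow> finite {x :: 'b ^ 'd::finite. \<forall>i. x $ i \<in> S i}"
  by (simp add: vec_box_eq finite_PiE)

lemma card_vec_box: "card {x :: 'b ^ 'd::finite. \<forall>i. x $ i \<in> S i} = (\<Prod>i\<in>UNIV. card (S i))"
  by (simp add: vec_box_eq card_image[OF inj_vec_lambda] card_PiE)

text \<open>Since exp of a multiple of \<open>l1\<close> is a product over the coordinates, this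
  turns lattice sums of such exponentials into powers of one-dimensional sums.\<close>

lemma sum_prod_vec_box:
  fixes g :: "'b \<Rightarrow> real"
  assumes "finite S"
  shows "(\<Sum>x\<in>{x :: 'b ^ 'd::finite. \<forall>i. x $ i \<in> S}. \<Prod>i\<in>UNIV. g (x $ i)) = (\<Sum>y\<in>S. g y) ^ CARD('d)"
  using assms
  using prod_sum_PiE[of "UNIV :: 'd set" "\<lambda>_. S" "\<lambda>_. g"]
  by (simp add: vec_box_eq sum.reindex[OF inj_vec_lambda])

lemma abs_coord_le_l1: "\<bar>x $ i\<bar> \<le> l1 x"
  unfolding l1_def by (rule member_le_sum) auto

lemma finite_cube: "finite (cube n :: 'd::finite site set)"
  and card_cube: "card (cube n :: 'd::finite site set) = (n + 1) ^ CARD('d)"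
proof -
  have eq: "(cube n :: 'd site set) = {x. \<forall>i. x $ i \<in> {0..int n}}"
    by (auto simp: cube_def)
  show "finite (cube n :: 'd site set)"
    unfolding eq by (rule finite_vec_box) simp
  show "card (cube n :: 'd site set) = (n + 1) ^ CARD('d)"
    unfolding eq card_vec_box by (simp add: nat_add_distrib)
qed

section \<open>Local events\<close>

lemma space_coord_algebra [simp]: "space (coord_algebra V) = UNIV"
  by (simp add: coord_algebra_def)

lemma sets_coord_algebra:
  "sets (coord_algebra V) = sigma_sets UNIV {(\<lambda>\<sigma>. \<sigma> x) -` B | x B. x \<in> V}"
  by (simp add: coord_algebra_def)

lemma coord_algebra_mono: "V \<subseteq> W \<Longrightarrow> sets (coord_algebra V) \<subseteq> sets (coord_algebra W)"
  unfolding sets_coord_algebra by (rule sigma_sets_mono') blast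

lemma coord_algebra_UNIV [simp]: "UNIV \<in> sets (coord_algebra V)"
  using sets.top[of "coord_algebra V"] by simp

lemma coord_algebra_Compl: "E \<in> sets (coord_algebra V) \<Longrightarrow> - E \<in> sets (coord_algebra V)"
  using sets.compl_sets[of E "coord_algebra V"] by (simp add: Compl_eq_Diff_UNIV)

lemma coord_event: "x \<in> V \<Longrightarrow> {\<sigma>. \<sigma> x = a} \<in> sets (coord_algebra V)"
  unfolding sets_coord_algebra
  by (rule sigma_sets.Basic) (auto intro!: exI[of _ x] exI[of _ "{a}"])

text \<open>The map \<open>f\<close> serves two uses: the identity for values prescribed at given
  sites, a translation for occurrences of a pattern elsewhere.\<close>

lemma local_pattern_event:
  assumes "finite S" "f ` S \<subseteq> V"
  shows "{\<sigma>. \<forall>x\<in>S. \<sigma> (f x) = \<eta> x} \<in> sets (coord_algebra V)"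
  using assms
proof induction
  case (insert x S)
  have "{\<sigma>. \<forall>y\<in>insert x S. \<sigma> (f y) = \<eta> y} = {\<sigma>. \<sigma> (f x) = \<eta> x} \<inter> {\<sigma>. \<forall>y\<in>S. \<sigma> (f y) = \<eta> y}"
    by auto
  then show ?case using insert coord_event[of "f x" V "\<eta> x"] by simp
qed simp

text \<open>Needed when the conditioning event reads no site: \<open>phi_mixing\<close> ranges over
  nonempty volumes only, and such an event is trivial.\<close>

lemma coord_algebra_empty: "E \<in> sets (coord_algebra {}) \<Longrightarrow> E = {} \<or> E = UNIV"
proof -
  assume "E \<in> sets (coord_algebra {})"
  then have "E \<in> sigma_sets UNIV {}" by (simp add: sets_coord_algebra)
  then show ?thesis
  proof (induction rule: sigma_sets.induct)
    case (Union a)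
    then show ?case by (cases "\<exists>i. a i = UNIV") auto
  qed auto
qed

lemma ti_random_field_facts:
  assumes "ti_random_field P"
  shows "prob_space P" "sets P = sets config_space" "space P = UNIV"
    "E \<in> sets (coord_algebra V) \<Longrightarrow> E \<in> sets P"
proof -
  show *: "prob_space P" "sets P = sets config_space"
    using assms by (auto simp: ti_random_field_def)
  show "space P = UNIV"
    using sets_eq_imp_space_eq[OF *(2)] by (simp add: config_space_def)
  show "E \<in> sets (coord_algebra V) \<Longrightarrow> E \<in> sets P"
    using subalgebra_coord_algebra[OF *(2), of V] by (auto simp: subalgebra_def)
qed

lemma translate_measurable:
  "translate x \<in> measurable config_space (config_space :: ('d::finite, 'a::finite) config measure)"
proof -
  have "translate x \<in> measurable (PiM UNIV (\<lambda>_. count_space UNIV)) (PiM UNIV (\<lambda>_. count_space UNIV))"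
    unfolding translate_def by (rule measurable_PiM_single') (auto simp: space_PiM)
  then show ?thesis
    using measurable_cong_sets[OF sets_config_space_eq_PiM sets_config_space_eq_PiM] by blast
qed

lemma measure_translate:
  assumes "ti_random_field P" "E \<in> sets P"
  shows "measure P (translate x -` E) = measure P E"
proof -
  note f = ti_random_field_facts[OF assms(1)]
  have d: "distr P config_space (translate x) = P"
    using assms(1) by (auto simp: ti_random_field_def)
  have m: "translate x \<in> measurable P config_space"
    using translate_measurable measurable_cong_sets[OF f(2) refl] by blast
  have "measure (distr P config_space (translate x)) E = measure P (translate x -` E)"
    using measure_distr[OF m, of E] assms(2) f(2,3) by simp
  then show ?thesis by (simp add: d)
qed

section \<open>Finite energy\<close>

text \<open>The sets meeting {x} are the translates by x of the sets containing 0, and translation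
  does not change the supremum of the interaction. So one summability constant bounds the energy at
  every site, for every boundary condition and every letter.\<close>

lemma hamiltonian_singleton_bound:
  fixes U :: "(int ^ 'd::finite) set \<Rightarrow> ('d, 'a::finite) config \<Rightarrow> real"
    and x :: "'d site"
  assumes "ti_interaction U"
  shows "\<bar>hamiltonian U {x} \<zeta> \<eta>\<bar> \<le> (\<Sum>\<^sub>\<infinity>A\<in>{A \<in> finite_volumes. 0 \<in> A}. SUP \<sigma>. \<bar>U A \<sigma>\<bar>)"
proof -
  let ?S = "\<lambda>A. SUP \<sigma>. \<bar>U A \<sigma>\<bar>"
  let ?O = "{A \<in> finite_volumes. (0 :: int ^ 'd) \<in> A}"
  let ?X = "{A \<in> finite_volumes. A \<inter> {x} \<noteq> {}}"
  have loc: "A \<in> finite_volumes \<Longrightarrow> \<forall>y\<in>A. \<sigma> y = \<sigma>' y \<Longrightarrow> U A \<sigma> = U A \<sigma>'" for A \<sigma> \<sigma>'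
    using assms unfolding ti_interaction_def by blast
  have tr: "A \<in> finite_volumes \<Longrightarrow> U ((\<lambda>y. y + z) ` A) (translate (- z) \<sigma>) = U A \<sigma>" for A z \<sigma>
    using assms unfolding ti_interaction_def by blast
  have sm: "?S summable_on ?O"
    using assms unfolding ti_interaction_def by blast
  \<comment> \<open>A real \<open>SUP\<close> says something only about bounded sets. Here
    \<open>U A\<close> factors through the finitely many restrictions to A.\<close>
  have bdd: "bdd_above (range (\<lambda>\<sigma>. \<bar>U A \<sigma>\<bar>))" if A: "A \<in> finite_volumes" for A
  proof -
    have "range (\<lambda>\<sigma>. \<bar>U A \<sigma>\<bar>) \<subseteq> (\<lambda>\<sigma>. \<bar>U A \<sigma>\<bar>) ` (A \<rightarrow>\<^sub>E UNIV)"
    proof safe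
      fix \<sigma>
      have "U A \<sigma> = U A (restrict \<sigma> A)" by (rule loc[OF A]) auto
      then show "\<bar>U A \<sigma>\<bar> \<in> (\<lambda>\<sigma>. \<bar>U A \<sigma>\<bar>) ` (A \<rightarrow>\<^sub>E UNIV)"
        by (intro image_eqI[of _ _ "restrict \<sigma> A"]) auto
    qed
    moreover have "finite (A \<rightarrow>\<^sub>E (UNIV :: 'a set))"
      using A by (intro finite_PiE) (auto simp: finite_volumes_def)
    ultimately show ?thesis by (meson bdd_above_finite finite_imageI finite_subset)
  qed
  have Strans: "?S ((\<lambda>y. y + x) ` A) = ?S A" if A: "A \<in> finite_volumes" for A
  proof -
    have "range (\<lambda>\<sigma>. \<bar>U ((\<lambda>y. y + x) ` A) \<sigma>\<bar>) = range (\<lambda>\<sigma>. \<bar>U A \<sigma>\<bar>)"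
    proof safe
      fix \<sigma> :: "('d, 'a) config"
      have "\<sigma> = translate (- x) (translate x \<sigma>)" by (auto simp: translate_def)
      then show "\<bar>U ((\<lambda>y. y + x) ` A) \<sigma>\<bar> \<in> range (\<lambda>\<sigma>. \<bar>U A \<sigma>\<bar>)"
        by (metis tr[OF A] rangeI)
    next
      fix \<sigma> :: "('d, 'a) config"
      show "\<bar>U A \<sigma>\<bar> \<in> range (\<lambda>\<sigma>. \<bar>U ((\<lambda>y. y + x) ` A) \<sigma>\<bar>)"
        by (metis tr[OF A] rangeI)
    qed
    then show ?thesis by simp
  qed
  have bij: "bij_betw ((`) (\<lambda>y. y + x)) ?O ?X"
  proof (rule bij_betwI[where g = "(`) (\<lambda>y. y - x)"])
    show "(`) (\<lambda>y. y + x) \<in> ?O \<rightarrow> ?X"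
    proof (intro Pi_I CollectI)
      fix A assume "A \<in> ?O"
      then have "0 + x \<in> (\<lambda>y. y + x) ` A" "A \<in> finite_volumes" by blast+
      then show "(\<lambda>y. y + x) ` A \<in> finite_volumes \<and> (\<lambda>y. y + x) ` A \<inter> {x} \<noteq> {}"
        by (auto simp: finite_volumes_def)
    qed
    show "(`) (\<lambda>y. y - x) \<in> ?X \<rightarrow> ?O"
    proof (intro Pi_I CollectI)
      fix A assume "A \<in> ?X"
      then have "x - x \<in> (\<lambda>y. y - x) ` A" "A \<in> finite_volumes" by blast+
      then show "(\<lambda>y. y - x) ` A \<in> finite_volumes \<and> 0 \<in> (\<lambda>y. y - x) ` A"
        by (auto simp: finite_volumes_def)
    qed
  qed (auto simp: image_image)
  have smX: "?S summable_on ?X"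
    using sm Strans summable_on_reindex_bij_betw[OF bij, of ?S]
    by (metis (no_types, lifting) mem_Collect_eq summable_on_cong)
  have sumX: "infsum ?S ?X = infsum ?S ?O"
    using Strans infsum_reindex_bij_betw[OF bij, of ?S]
    by (metis (no_types, lifting) mem_Collect_eq infsum_cong)
  let ?t = "\<lambda>A. U A (override_on \<zeta> \<eta> {x})"
  have le: "norm (?t A) \<le> ?S A" if "A \<in> ?X" for A
    using bdd[of A] that by (auto intro!: cSUP_upper)
  have abs: "(\<lambda>A. norm (?t A)) summable_on ?X"
    by (rule Infinite_Sum.abs_summable_on_comparison_test'[OF smX le])
  have "\<bar>infsum ?t ?X\<bar> \<le> infsum (\<lambda>A. norm (?t A)) ?X"
    using norm_infsum_bound[OF abs] by simp
  also have "\<dots> \<le> infsum ?S ?X"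
    by (rule infsum_mono[OF abs smX le])
  finally show ?thesis unfolding sumX hamiltonian_def .
qed

text \<open>Boltzmann weights at one site lie between exp (- M) and exp M, so the conditional
  probability of each letter is at least exp (- M) / (CARD('a) * exp M), whatever the rest of the
  configuration. Integrating over E turns this almost sure bound into one for events, which can be
  iterated.\<close>

lemma single_site_energy:
  fixes U :: "(int ^ 'd::finite) set \<Rightarrow> ('d, 'a::finite) config \<Rightarrow> real"
  assumes U: "ti_interaction U" and G: "ti_gibbs_field U P"
  obtains \<delta> where "\<delta> > 0"
    "\<And>(x :: 'd site) (a :: 'a) (E :: ('d, 'a) config set). E \<in> sets (coord_algebra (- {x})) \<Longrightarrow> \<delta> * measure P E \<le> measure P (E \<inter> {\<sigma>. \<sigma> x = a})"
proof
  define M where "M = (\<Sum>\<^sub>\<infinity>A\<in>{A \<in> finite_volumes. 0 \<in> A}. SUP \<sigma>. \<bar>U A \<sigma>\<bar>)"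
  define \<delta> where "\<delta> = exp (- M) / (real CARD('a) * exp M)"
  show "\<delta> > 0" by (simp add: \<delta>_def)
  have rf: "ti_random_field P" using G by (simp add: ti_gibbs_field_def)
  note f = ti_random_field_facts[OF rf]
  interpret prob_space P by (rule f(1))
  fix x :: "'d site" and a :: 'a and E :: "('d, 'a) config set" assume E: "E \<in> sets (coord_algebra (- {x}))"
  interpret finite_measure_subalgebra P "coord_algebra (- {x})"
    by unfold_locales (rule subalgebra_coord_algebra[OF f(2)])
  define \<eta> where "\<eta> = restrict (\<lambda>_. a) {x}"
  let ?C = "cylinder {x} \<eta> :: ('d, 'a) config set"
  have Ceq: "?C = {\<sigma>. \<sigma> x = a}"
    by (auto simp: cylinder_def \<eta>_def restrict_def fun_eq_iff)
  have Cs: "?C \<in> sets P"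
    unfolding Ceq using coord_event[of x UNIV a] f(4) by blast
  have Es: "E \<in> sets P" using E f(4) by blast
  have V: "{x} \<in> finite_volumes" by (simp add: finite_volumes_def)
  have pat: "\<eta> \<in> patterns {x}" by (auto simp: patterns_def \<eta>_def)
  have cond: "AE \<zeta> in P. real_cond_exp P (coord_algebra (- {x})) (indicator ?C) \<zeta> =
        exp (- hamiltonian U {x} \<zeta> \<eta>) / (\<Sum>\<eta>'\<in>patterns {x}. exp (- hamiltonian U {x} \<zeta> \<eta>'))"
    using G V pat unfolding ti_gibbs_field_def by blast
  have Hb: "\<bar>hamiltonian U {x} \<zeta> \<eta>'\<bar> \<le> M" for \<zeta> \<eta>'
    unfolding M_def by (rule hamiltonian_singleton_bound[OF U])
  have card: "card (patterns {x} :: ('d, 'a) config set) = CARD('a)"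
    by (simp add: patterns_def card_PiE)
  have fin: "finite (patterns {x} :: ('d, 'a) config set)"
    by (simp add: patterns_def finite_PiE)
  have ge: "AE \<zeta> in P. \<delta> \<le> real_cond_exp P (coord_algebra (- {x})) (indicator ?C) \<zeta>"
    using cond
  proof eventually_elim
    fix \<zeta> assume eq: "real_cond_exp P (coord_algebra (- {x})) (indicator ?C) \<zeta> =
        exp (- hamiltonian U {x} \<zeta> \<eta>) / (\<Sum>\<eta>'\<in>patterns {x}. exp (- hamiltonian U {x} \<zeta> \<eta>'))"
    have "(\<Sum>\<eta>'\<in>patterns {x}. exp (- hamiltonian U {x} \<zeta> \<eta>')) \<le> (\<Sum>\<eta>'\<in>(patterns {x} :: ('d, 'a) config set). exp M)"
    proof (rule sum_mono)
      fix \<eta>' show "exp (- hamiltonian U {x} \<zeta> \<eta>') \<le> exp M"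
        using Hb[of \<zeta> \<eta>'] by simp
    qed
    also have "\<dots> = real CARD('a) * exp M" by (simp add: card)
    finally have le: "(\<Sum>\<eta>'\<in>patterns {x}. exp (- hamiltonian U {x} \<zeta> \<eta>')) \<le> real CARD('a) * exp M" .
    have pos: "0 < (\<Sum>\<eta>'\<in>patterns {x}. exp (- hamiltonian U {x} \<zeta> \<eta>'))"
      by (rule sum_pos[OF fin]) (use pat in auto)
    have "exp (- M) \<le> exp (- hamiltonian U {x} \<zeta> \<eta>)"
      using Hb[of \<zeta> \<eta>] by simp
    then show "\<delta> \<le> real_cond_exp P (coord_algebra (- {x})) (indicator ?C) \<zeta>"
      unfolding eq \<delta>_def by (intro frac_le) (use le pos in auto)
  qed
  have int: "integrable P (indicator ?C :: _ \<Rightarrow> real)"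
    using Cs by (simp add: integrable_indicator_iff emeasure_eq_measure)
  have "\<delta> * measure P E = (\<integral>x\<in>E. \<delta> \<partial>P)"
    using Es by (simp add: set_lebesgue_integral_def emeasure_eq_measure f(3))
  also have "\<dots> \<le> (\<integral>y\<in>E. real_cond_exp P (coord_algebra (- {x})) (indicator ?C) y \<partial>P)"
  proof (rule set_integral_mono_AE)
    show "set_integrable P E (\<lambda>_. \<delta>)"
      using Es by (simp add: set_integrable_def integrable_indicator_iff emeasure_eq_measure)
    show "set_integrable P E (real_cond_exp P (coord_algebra (- {x})) (indicator ?C))"
      unfolding set_integrable_def
      by (rule integrable_mult_indicator[OF Es real_cond_exp_int(1)[OF int]])
  qed (use ge in auto)
  also have "\<dots> = (\<integral>y\<in>E. indicator ?C y \<partial>P)"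
    by (rule real_cond_exp_intA[OF int E, symmetric])
  also have "\<dots> = measure P (E \<inter> ?C)"
    using Es Cs by (simp add: set_lebesgue_integral_def indicator_inter_arith[symmetric] f(3))
  finally show "\<delta> * measure P E \<le> measure P (E \<inter> {\<sigma>. \<sigma> x = a})" by (simp add: Ceq)
qed

text \<open>A second letter claims a fixed share of the mass of every event that does not read x, so
  no letter gets all of it; going through V site by site multiplies these bounds. The lower bound,
  iterated in the same way, gives positivity.\<close>

lemma finite_volume_energy:
  fixes U :: "(int ^ 'd::finite) set \<Rightarrow> ('d, 'a::finite) config \<Rightarrow> real"
  assumes U: "ti_interaction U" and G: "ti_gibbs_field U P" and A: "CARD('a) \<ge> 2"
  obtains \<gamma> where "0 < \<gamma>" "\<gamma> < 1"
    "\<And>V (E :: ('d, 'a) config set) \<eta>. finite V \<Longrightarrow> E \<in> sets (coord_algebra (- V)) \<Longrightarrow>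
       measure P (E \<inter> {\<sigma>. \<forall>x\<in>V. \<sigma> x = \<eta> x}) \<le> \<gamma> ^ card V * measure P E"
    "\<And>V (\<eta> :: ('d, 'a) config). finite V \<Longrightarrow> 0 < measure P {\<sigma>. \<forall>x\<in>V. \<sigma> x = \<eta> x}"
proof -
  obtain \<delta> where \<delta>: "\<delta> > 0"
    "\<And>(x :: 'd site) (a :: 'a) (E :: ('d, 'a) config set). E \<in> sets (coord_algebra (- {x})) \<Longrightarrow> \<delta> * measure P E \<le> measure P (E \<inter> {\<sigma>. \<sigma> x = a})"
    using single_site_energy[OF U G] by metis
  have rf: "ti_random_field P" using G by (simp add: ti_gibbs_field_def)
  note f = ti_random_field_facts[OF rf]
  interpret prob_space P by (rule f(1))
  \<comment> \<open>Only \<open>\<delta> > 0\<close> is known here; the cap 1/2 keeps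
    \<open>\<gamma>\<close> positive.\<close>
  define \<gamma> where "\<gamma> = 1 - min \<delta> (1/2)"
  have \<gamma>: "0 < \<gamma>" "\<gamma> < 1" using \<delta>(1) by (auto simp: \<gamma>_def)
  have up: "measure P (E \<inter> {\<sigma>. \<sigma> x = a}) \<le> \<gamma> * measure P E"
    if E: "E \<in> sets (coord_algebra (- {x}))" for x :: "'d site" and a :: 'a and E :: "('d, 'a) config set"
  proof -
    obtain a' where a': "a' \<noteq> a"
    proof -
      have "\<not> CARD('a) \<le> Suc 0" using A by simp
      then show ?thesis using that by (auto simp: card_le_Suc0_iff_eq) metis
    qed
    have c: "{\<sigma>. \<sigma> x = b} \<in> events" for b using coord_event[of x UNIV b] f(4) by blast
    have "measure P (E \<inter> {\<sigma>. \<sigma> x = a}) + measure P (E \<inter> {\<sigma>. \<sigma> x = a'})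
        = measure P (E \<inter> {\<sigma>. \<sigma> x = a} \<union> E \<inter> {\<sigma>. \<sigma> x = a'})"
      using a' c E f(4) by (intro finite_measure_Union[symmetric]) blast+
    also have "\<dots> \<le> measure P E"
      using E f(4) by (intro finite_measure_mono) auto
    finally have "measure P (E \<inter> {\<sigma>. \<sigma> x = a}) \<le> measure P E - \<delta> * measure P E"
      using \<delta>(2)[OF E, of a'] by simp
    also have "\<dots> \<le> measure P E - min \<delta> (1/2) * measure P E"
      by (intro diff_left_mono mult_right_mono) auto
    finally show ?thesis by (simp add: \<gamma>_def algebra_simps)
  qed
  show thesis
  proof (rule that[OF \<gamma>])
    fix V :: "'d site set" and E :: "('d, 'a) config set" and \<eta> :: "('d, 'a) config" assume "finite V" "E \<in> sets (coord_algebra (- V))"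
    then show "measure P (E \<inter> {\<sigma>. \<forall>x\<in>V. \<sigma> x = \<eta> x}) \<le> \<gamma> ^ card V * measure P E"
    proof (induction V)
      case (insert x V)
      have E: "E \<in> sets (coord_algebra (- V))" "E \<in> sets (coord_algebra (- {x}))"
        using insert.prems coord_algebra_mono[of "- insert x V" "- V"]
          coord_algebra_mono[of "- insert x V" "- {x}"] by auto
      have "{\<sigma>. \<forall>y\<in>V. \<sigma> y = \<eta> y} \<in> sets (coord_algebra (- {x}))"
        using local_pattern_event[of V "\<lambda>x. x" "- {x}" \<eta>] insert.hyps by auto
      then have "E \<inter> {\<sigma>. \<forall>y\<in>V. \<sigma> y = \<eta> y} \<in> sets (coord_algebra (- {x}))"
        using E by blast
      from up[OF this, of "\<eta> x"]
      have "measure P (E \<inter> {\<sigma>. \<forall>y\<in>V. \<sigma> y = \<eta> y} \<inter> {\<sigma>. \<sigma> x = \<eta> x})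
          \<le> \<gamma> * measure P (E \<inter> {\<sigma>. \<forall>y\<in>V. \<sigma> y = \<eta> y})" .
      also have "\<dots> \<le> \<gamma> * (\<gamma> ^ card V * measure P E)"
        using insert.IH[OF E(1)] \<gamma> by simp
      also have "E \<inter> {\<sigma>. \<forall>y\<in>V. \<sigma> y = \<eta> y} \<inter> {\<sigma>. \<sigma> x = \<eta> x} = E \<inter> {\<sigma>. \<forall>y\<in>insert x V. \<sigma> y = \<eta> y}"
        by auto
      finally show ?case using insert.hyps by simp
    qed simp
  next
    fix V :: "'d site set" and \<eta> :: "('d, 'a) config" assume "finite V"
    then show "0 < measure P {\<sigma>. \<forall>x\<in>V. \<sigma> x = \<eta> x}"
    proof (induction V)
      case empty
      then show ?case using prob_space f(3) by simp
    next
      case (insert x V)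
      have "{\<sigma>. \<forall>y\<in>V. \<sigma> y = \<eta> y} \<in> sets (coord_algebra (- {x}))"
        using local_pattern_event[of V "\<lambda>x. x" "- {x}" \<eta>] insert.hyps by auto
      from \<delta>(2)[OF this, of "\<eta> x"]
      have "\<delta> * measure P {\<sigma>. \<forall>y\<in>V. \<sigma> y = \<eta> y} \<le> measure P ({\<sigma>. \<forall>y\<in>V. \<sigma> y = \<eta> y} \<inter> {\<sigma>. \<sigma> x = \<eta> x})" .
      moreover have "{\<sigma>. \<forall>y\<in>V. \<sigma> y = \<eta> y} \<inter> {\<sigma>. \<sigma> x = \<eta> x} = {\<sigma>. \<forall>y\<in>insert x V. \<sigma> y = \<eta> y}"
        by auto
      ultimately show ?case using insert.IH \<delta>(1) by (smt (verit) mult_pos_pos)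
    qed
  qed
qed

section \<open>Mixing\<close>

text \<open>Multiplying the mixing inequality by the probability of F makes the error relative to
  that event. This form also covers null events F and an empty T, both excluded in
  \<open>phi_mixing\<close>.\<close>

lemma exp_phi_mixing_bound:
  fixes P :: "('d::finite, 'a::finite) config measure"
  assumes rf: "ti_random_field P" and mix: "exp_phi_mixing P"
  obtains C1 C2 where "C1 > 0" "C2 > 0"
    "\<And>S T m (E :: ('d, 'a) config set) F. \<lbrakk>finite S; finite T; S \<noteq> {}; m > 0; \<And>x y. x \<in> S \<Longrightarrow> y \<in> T \<Longrightarrow> m \<le> real_of_int (l1 (x - y));
       E \<in> sets (coord_algebra S); F \<in> sets (coord_algebra T)\<rbrakk> \<Longrightarrow>
       \<bar>measure P (E \<inter> F) - measure P E * measure P F\<bar> \<le> real (card S) * (C1 * exp (- C2 * m)) * measure P F"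
proof -
  obtain C1 C2 where C: "C1 > 0" "C2 > 0" "\<And>m. m > 0 \<Longrightarrow> phi_mixing P m \<le> C1 * exp (- C2 * m)"
    using mix unfolding exp_phi_mixing_def by metis
  note f = ti_random_field_facts[OF rf]
  interpret prob_space P by (rule f(1))
  show thesis
  proof (rule that[OF C(1,2)])
    fix S T :: "'d site set" and m and E F :: "('d, 'a) config set"
    assume S: "finite S" and T: "finite T" and S0: "S \<noteq> {}" and m: "m > 0"
      and sep: "\<And>x y. x \<in> S \<Longrightarrow> y \<in> T \<Longrightarrow> m \<le> real_of_int (l1 (x - y))"
      and E: "E \<in> sets (coord_algebra S)" and F: "F \<in> sets (coord_algebra T)"
    have cS: "real (card S) > 0" using S S0 by (simp add: card_gt_0_iff)
    have nn: "0 \<le> real (card S) * (C1 * exp (- C2 * m)) * prob F" using C by simp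
    show "\<bar>prob (E \<inter> F) - prob E * prob F\<bar> \<le> real (card S) * (C1 * exp (- C2 * m)) * prob F"
    proof (cases "prob F = 0 \<or> F = UNIV")
      case True
      then show ?thesis
      proof
        assume "prob F = 0"
        moreover have "prob (E \<inter> F) \<le> prob F"
          using F f(4) by (intro finite_measure_mono) auto
        ultimately show ?thesis using nn measure_nonneg[of P "E \<inter> F"] by simp
      next
        assume "F = UNIV"
        then show ?thesis using nn prob_space f(3) by simp
      qed
    next
      case False
      then have F0: "prob F > 0" "F \<noteq> UNIV" using measure_nonneg[of P F] by linarith+
      then have T0: "T \<noteq> {}" using coord_algebra_empty[of F] F by auto
      let ?X = "{1 / real (card A1) * \<bar>\<P>(\<sigma> in P. \<sigma> \<in> E1 \<bar> \<sigma> \<in> E2) - measure P E1\<bar> | A1 A2 E1 E2.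
            A1 \<in> finite_volumes \<and> A2 \<in> finite_volumes \<and> real_of_int (set_distance A1 A2) \<ge> m \<and>
            E1 \<in> sets (coord_algebra A1) \<and> E2 \<in> sets (coord_algebra A2) \<and> measure P E2 > 0}"
      have cp: "\<P>(\<sigma> in P. \<sigma> \<in> E1 \<bar> \<sigma> \<in> E2) = prob (E1 \<inter> E2) / prob E2" for E1 E2
        by (simp add: cond_prob_def f(3) Collect_conj_eq)
      \<comment> \<open>An element is bounded by \<open>Sup\<close> only if the set is bounded
        above; each entry is a difference of probabilities divided by a cardinality of at least
        1.\<close>
      have bdd: "bdd_above ?X"
      proof (rule bdd_aboveI[of _ 1], safe)
        fix A1 A2 :: "'d site set" and E1 E2 :: "('d, 'a) config set"
        assume *: "A1 \<in> finite_volumes" "A2 \<in> finite_volumes" "E1 \<in> sets (coord_algebra A1)"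
          "E2 \<in> sets (coord_algebra A2)" "prob E2 > 0"
        have "prob (E1 \<inter> E2) \<le> prob E2" using * f(4) by (intro finite_measure_mono) auto
        then have "prob (E1 \<inter> E2) / prob E2 \<le> 1" "0 \<le> prob (E1 \<inter> E2) / prob E2" using * by auto
        then have 1: "\<bar>prob (E1 \<inter> E2) / prob E2 - prob E1\<bar> \<le> 1"
          using measure_nonneg[of P E1] prob_le_1[of E1] by linarith
        have "card A1 > 0" using *(1) by (auto simp: finite_volumes_def card_gt_0_iff)
        then have "1 / real (card A1) \<le> 1" by simp
        then show "1 / real (card A1) * \<bar>\<P>(\<sigma> in P. \<sigma> \<in> E1 \<bar> \<sigma> \<in> E2) - prob E1\<bar> \<le> 1"
          unfolding cp using 1 by (intro mult_le_one) auto
      qed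
      have fd: "finite {l1 (x - y) | x y. x \<in> S \<and> y \<in> T}"
        using S T by (simp add: finite_image_set2)
      have sd: "real_of_int (set_distance S T) \<ge> m"
      proof -
        have "set_distance S T \<in> {l1 (x - y) | x y. x \<in> S \<and> y \<in> T}"
          unfolding set_distance_def by (rule Min_in[OF fd]) (use S0 T0 in auto)
        then show ?thesis using sep by auto
      qed
      have "1 / real (card S) * \<bar>\<P>(\<sigma> in P. \<sigma> \<in> E \<bar> \<sigma> \<in> F) - prob E\<bar> \<in> ?X"
        using S T S0 T0 sd E F F0 by (auto simp: finite_volumes_def)
      then have "1 / real (card S) * \<bar>\<P>(\<sigma> in P. \<sigma> \<in> E \<bar> \<sigma> \<in> F) - prob E\<bar> \<le> phi_mixing P m"
        unfolding phi_mixing_def using bdd by (rule cSup_upper)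
      also have "\<dots> \<le> C1 * exp (- C2 * m)" by (rule C(3)[OF m])
      finally have "\<bar>prob (E \<inter> F) / prob F - prob E\<bar> \<le> real (card S) * (C1 * exp (- C2 * m))"
        using cS unfolding cp by (simp add: field_simps)
      moreover have "prob (E \<inter> F) - prob E * prob F = (prob (E \<inter> F) / prob F - prob E) * prob F"
        using F0 by (simp add: field_simps)
      ultimately show ?thesis using F0 by (simp add: abs_mult mult_right_mono)
    qed
  qed
qed

section \<open>Elementary bounds for exponentials\<close>

lemma power_le_fact_exp:
  fixes x :: real
  assumes "x \<ge> 0"
  shows "x ^ k \<le> fact k * exp x"
proof -
  have "(\<Sum>i\<in>{k}. x ^ i /\<^sub>R fact i) \<le> exp x"
    unfolding exp_def by (rule sum_le_suminf[OF summable_exp_generic]) (use assms in auto)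
  then show ?thesis by (simp add: divide_simps mult.commute)
qed

text \<open>Two geometric series, one for each sign; counting j = 0 twice accounts for the numerator
  2.\<close>

lemma sum_exp_abs_le:
  fixes \<kappa> :: real
  assumes "\<kappa> > 0"
  shows "(\<Sum>j\<in>{- int m..int m}. exp (- \<kappa> * \<bar>real_of_int j\<bar>)) \<le> 2 / (1 - exp (- \<kappa>))"
proof -
  have g: "(\<Sum>j\<le>m. exp (- \<kappa> * real j)) \<le> 1 / (1 - exp (- \<kappa>))"
  proof -
    have eq: "exp (- \<kappa> * real j) = exp (- \<kappa>) ^ j" for j
      by (simp add: exp_of_nat_mult[symmetric] mult.commute)
    have "(\<Sum>j\<le>m. exp (- \<kappa>) ^ j) \<le> (\<Sum>j. exp (- \<kappa>) ^ j)"
      by (rule sum_le_suminf) (use assms in \<open>auto intro!: summable_geometric\<close>)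
    also have "\<dots> = 1 / (1 - exp (- \<kappa>))"
      by (rule suminf_geometric) (use assms in auto)
    finally show ?thesis unfolding eq .
  qed
  have "(\<Sum>j\<in>{- int m..int m}. exp (- \<kappa> * \<bar>real_of_int j\<bar>))
      \<le> (\<Sum>j\<in>int ` {..m} \<union> (\<lambda>j. - int j) ` {..m}. exp (- \<kappa> * \<bar>real_of_int j\<bar>))"
  proof (rule sum_mono2)
    show "{- int m..int m} \<subseteq> int ` {..m} \<union> (\<lambda>j. - int j) ` {..m}"
    proof
      fix j assume "j \<in> {- int m..int m}"
      then show "j \<in> int ` {..m} \<union> (\<lambda>j. - int j) ` {..m}"
        by (cases j rule: int_cases2) auto
    qed
  qed auto
  also have "\<dots> \<le> (\<Sum>j\<in>int ` {..m}. exp (- \<kappa> * \<bar>real_of_int j\<bar>))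
      + (\<Sum>j\<in>(\<lambda>j. - int j) ` {..m}. exp (- \<kappa> * \<bar>real_of_int j\<bar>))"
    by (subst sum_Un) (auto intro!: sum_nonneg)
  also have "\<dots> = (\<Sum>j\<le>m. exp (- \<kappa> * real j)) + (\<Sum>j\<le>m. exp (- \<kappa> * real j))"
    by (simp add: sum.reindex inj_on_def)
  also have "\<dots> \<le> 2 / (1 - exp (- \<kappa>))" using g by simp
  finally show ?thesis .
qed

section \<open>Occurrences of a pattern\<close>

text \<open>From here on the interaction is visible only through \<open>energy\<close> and
  \<open>cylinder_pos\<close>. Neither n nor a pattern is fixed yet, so the constants defined at
  this level are uniform over all patterns.\<close>

locale mixing_field =
  fixes P :: "('d::finite, 'a::finite) config measure" and C1 C2 \<gamma> :: real
  assumes random_field: "ti_random_field P"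
    and C1_pos: "C1 > 0" and C2_pos: "C2 > 0" and \<gamma>_pos: "\<gamma> > 0" and \<gamma>_less_1: "\<gamma> < 1"
    and mixing: "\<lbrakk>finite S; finite T; S \<noteq> {}; m > 0; \<And>x y. x \<in> S \<Longrightarrow> y \<in> T \<Longrightarrow> m \<le> real_of_int (l1 (x - y));
       E \<in> sets (coord_algebra S); F \<in> sets (coord_algebra T)\<rbrakk> \<Longrightarrow>
       \<bar>measure P (E \<inter> F) - measure P E * measure P F\<bar> \<le> real (card S) * (C1 * exp (- C2 * m)) * measure P F"
    and energy: "\<lbrakk>finite V; E \<in> sets (coord_algebra (- V))\<rbrakk> \<Longrightarrow>
       measure P (E \<inter> {\<sigma>. \<forall>x\<in>V. \<sigma> x = \<eta> x}) \<le> \<gamma> ^ card V * measure P E"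
    and cylinder_pos: "finite V \<Longrightarrow> 0 < measure P {\<sigma>. \<forall>x\<in>V. \<sigma> x = \<eta> x}"
begin

sublocale prob_space P by (rule ti_random_field_facts(1)[OF random_field])

lemma space_UNIV [simp]: "space P = UNIV"
  and local_event: "E \<in> sets (coord_algebra V) \<Longrightarrow> E \<in> sets P"
  using ti_random_field_facts[OF random_field] by auto

text \<open>The 1 serves pairs of nearby occurrences. The other term is what remains after the
  volume factor (n + 1)^d of the mixing bound has been absorbed into part of the exponential by
  \<open>power_le_fact_exp\<close>.\<close>

definition decay_const :: real where
  "decay_const = 1 + C1 * (fact CARD('d) * (4 / C2) ^ CARD('d))"

text \<open>The first rate stems from finite energy, halved because a second occurrence at distance
  J up to 2 * (n + 1) prescribes at least J / 2 new sites. The second is the mixing rate, halved for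
  the extent of the patterns and again for the volume factor. Division by d passes from the largest
  coordinate to \<open>l1\<close>.\<close>

definition decay_rate :: real where
  "decay_rate = min (ln (1 / \<gamma>) / 2) (C2 / 4) / real CARD('d)"

text \<open>The second term bounds the lattice sum of the decaying part of
  \<open>pair_bound\<close>; the 1 leaves room for the independent part, a mean of at most 1 in
  \<open>hitting_lower_bound\<close>.\<close>

definition cluster_const :: real where
  "cluster_const = 1 + decay_const * (2 / (1 - exp (- decay_rate))) ^ CARD('d)"

lemma decay_const_ge_1: "decay_const \<ge> 1"
  using C1_pos C2_pos by (simp add: decay_const_def)

lemma decay_rate_pos: "decay_rate > 0"
  using C2_pos \<gamma>_pos \<gamma>_less_1 by (simp add: decay_rate_def)

lemma cluster_const_ge_1: "cluster_const \<ge> 1"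
  using decay_const_ge_1 decay_rate_pos by (simp add: cluster_const_def)

end

text \<open>Separation in one coordinate suits boxes, and since \<open>l1\<close> dominates every
  coordinate it implies the distance that mixing requires.\<close>

definition separated :: "int \<Rightarrow> 'd::finite site set \<Rightarrow> 'd site set \<Rightarrow> bool" where
  "separated L V W \<longleftrightarrow> (\<forall>x\<in>V. \<forall>y\<in>W. \<exists>i. L \<le> \<bar>x $ i - y $ i\<bar>)"

locale pattern_field = mixing_field P C1 C2 \<gamma>
  for P :: "('d::finite, 'a::finite) config measure" and C1 C2 \<gamma> :: real +
  fixes n :: nat and A :: "('d, 'a) config"
begin

definition occ :: "'d site \<Rightarrow> ('d, 'a) config set" where
  "occ x = {\<sigma>. \<forall>c\<in>cube n. \<sigma> (x + c) = A c}"

definition avoid :: "'d site set \<Rightarrow> ('d, 'a) config set" where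
  "avoid V = - (\<Union>x\<in>V. occ x)"

definition q :: "'d site set \<Rightarrow> real" where
  "q V = prob (avoid V)"

definition p :: real where
  "p = prob (occ 0)"

text \<open>The sites on which occurrences with base point in V depend.\<close>

definition sites :: "'d site set \<Rightarrow> 'd site set" where
  "sites V = (\<lambda>(x, c). x + c) ` (V \<times> cube n)"

lemma finite_sites: "finite V \<Longrightarrow> finite (sites V)"
  by (simp add: sites_def finite_cube)

lemma card_sites_le: "finite V \<Longrightarrow> card (sites V) \<le> card V * (n + 1) ^ CARD('d)"
  unfolding sites_def
  by (metis card_cartesian_product card_cube card_image_le finite_cartesian_product finite_cube)

lemma zero_in_cube: "0 \<in> cube n"
  by (simp add: cube_def)

lemma occ_local: "x \<in> V \<Longrightarrow> occ x \<in> sets (coord_algebra (sites V))"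
  unfolding occ_def by (rule local_pattern_event[OF finite_cube]) (auto simp: sites_def)

lemma avoid_local: "finite V \<Longrightarrow> avoid V \<in> sets (coord_algebra (sites V))"
  unfolding avoid_def by (intro coord_algebra_Compl sets.finite_UN occ_local)

lemma occ_event [measurable]: "occ x \<in> events"
  using occ_local[of x "{x}"] local_event by blast

lemma avoid_event: "finite V \<Longrightarrow> avoid V \<in> events"
  using avoid_local local_event by blast

lemma avoid_Un: "avoid (V \<union> W) = avoid V \<inter> avoid W"
  by (auto simp: avoid_def)

lemma q_nonneg: "0 \<le> q V" and q_le_1: "q V \<le> 1"
  by (simp_all add: q_def)

lemma q_empty [simp]: "q {} = 1"
  using prob_space by (simp add: q_def avoid_def)

lemma q_antimono: "finite W \<Longrightarrow> V \<subseteq> W \<Longrightarrow> q W \<le> q V"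
  unfolding q_def
  by (intro finite_measure_mono avoid_event) (auto simp: avoid_def intro: finite_subset)

lemma prob_occ: "prob (occ x) = p"
proof -
  have "translate x -` occ 0 = occ x" by (auto simp: occ_def translate_def)
  then show ?thesis unfolding p_def
    using measure_translate[OF random_field, of "occ 0" x] by simp
qed

lemma q_translate: "finite V \<Longrightarrow> q ((+) x ` V) = q V"
proof -
  assume "finite V"
  have "translate x -` avoid V = avoid ((+) x ` V)"
    by (simp add: set_eq_iff avoid_def occ_def translate_def add.assoc)
  then show ?thesis unfolding q_def
    using measure_translate[OF random_field avoid_event[OF \<open>finite V\<close>], of x] by simp
qed

lemma q_removal: "finite V \<Longrightarrow> finite T \<Longrightarrow> q V - q (V \<union> T) = prob (avoid V - avoid T)"
  unfolding q_def
  by (subst finite_measure_Diff'[OF avoid_event avoid_event]) (auto simp: avoid_Un)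

text \<open>By \<open>q_removal\<close> each side is the probability of avoiding one set while
  hitting T, and avoiding a larger set is rarer. This is what permits thinning W near T before
  mixing is applied.\<close>

lemma q_submodular:
  assumes "finite W" "finite T" "V \<subseteq> W"
  shows "q W - q (W \<union> T) \<le> q V - q (V \<union> T)"
proof -
  have V: "finite V" using assms finite_subset by blast
  have "prob (avoid W - avoid T) \<le> prob (avoid V - avoid T)"
    using assms V by (intro finite_measure_mono sets.Diff avoid_event) (auto simp: avoid_def)
  then show ?thesis using assms V by (simp add: q_removal)
qed

lemma q_union_bound:
  assumes "finite T"
  shows "1 - q T \<le> real (card T) * p"
proof -
  have "1 - q T = prob (\<Union>x\<in>T. occ x)"
    using prob_compl[of "\<Union>x\<in>T. occ x"] assms
    by (simp add: q_def avoid_def Compl_eq_Diff_UNIV)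
  also have "\<dots> \<le> (\<Sum>x\<in>T. prob (occ x))"
    by (rule finite_measure_subadditive_finite) (use assms in auto)
  finally show ?thesis by (simp add: prob_occ)
qed

lemma l1_sites:
  assumes "separated L V W" "x \<in> sites V" "y \<in> sites W"
  shows "L - int n \<le> l1 (x - y)"
proof -
  obtain x' c where x: "x' \<in> V" "c \<in> cube n" "x = x' + c" using assms by (auto simp: sites_def)
  obtain y' c' where y: "y' \<in> W" "c' \<in> cube n" "y = y' + c'" using assms by (auto simp: sites_def)
  obtain i where i: "L \<le> \<bar>x' $ i - y' $ i\<bar>" using assms x y by (auto simp: separated_def)
  have "0 \<le> c $ i" "c $ i \<le> int n" "0 \<le> c' $ i" "c' $ i \<le> int n"
    using x(2) y(2) by (auto simp: cube_def)
  moreover have "(x - y) $ i = (x' $ i - y' $ i) + (c $ i - c' $ i)" using x y by simp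
  ultimately have "L - int n \<le> \<bar>(x - y) $ i\<bar>" using i by linarith
  then show ?thesis using abs_coord_le_l1[of "x - y" i] by linarith
qed

lemma local_mixing:
  assumes "finite V" "finite W" "V \<noteq> {}" "separated L V W" "int n < L"
    and "E \<in> sets (coord_algebra (sites V))" "F \<in> sets (coord_algebra (sites W))"
  shows "\<bar>prob (E \<inter> F) - prob E * prob F\<bar>
    \<le> real (card (sites V)) * (C1 * exp (- C2 * (real_of_int L - real n))) * prob F"
proof (rule mixing)
  show "sites V \<noteq> {}" using assms(3) zero_in_cube by (auto simp: sites_def)
  show "real_of_int L - real n \<le> real_of_int (l1 (x - y))" if "x \<in> sites V" "y \<in> sites W" for x y
    using l1_sites[OF assms(4) that] by linarith
qed (use assms finite_sites in auto)

lemma q_mixing: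
  assumes "finite V" "finite W" "separated L V W" "int n < L"
  shows "\<bar>q (W \<union> V) - q V * q W\<bar>
    \<le> real (card (sites V)) * (C1 * exp (- C2 * (real_of_int L - real n))) * q W"
proof (cases "V = {}")
  case True
  then show ?thesis using C1_pos by (simp add: q_nonneg)
next
  case False
  then show ?thesis
    using local_mixing[OF assms(1,2) False assms(3,4) avoid_local avoid_local] assms(1,2)
    by (simp add: q_def avoid_Un Int_commute)
qed

subsection \<open>Clustering of occurrences\<close>

lemma p_pos: "0 < p"
  using cylinder_pos[OF finite_cube, where \<eta> = A] by (simp add: p_def occ_def)

text \<open>The cube has (n + 1)^d sites, but the weaker exponent suffices: it makes n at most
  logarithmic in 1 / p and bounds n for the patterns above a threshold.\<close>

lemma p_le: "p \<le> \<gamma> ^ (n + 1)"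
proof -
  have "p \<le> \<gamma> ^ card (cube n :: 'd site set)"
    using energy[OF finite_cube coord_algebra_UNIV, where \<eta> = A] prob_space by (simp add: p_def occ_def)
  also have "\<dots> \<le> \<gamma> ^ (n + 1)"
    unfolding card_cube using \<gamma>_pos \<gamma>_less_1
    by (intro power_decreasing self_le_power) auto
  finally show ?thesis .
qed

text \<open>On the line through y in direction i, the occurrence at y prescribes that many sites
  beyond the reach of the occurrence at x, or the other way round. Finite energy charges a factor
  \<open>\<gamma>\<close> for each.\<close>

lemma pair_energy:
  "prob (occ x \<inter> occ y) \<le> p * \<gamma> ^ min (nat \<bar>y $ i - x $ i\<bar>) (n + 1)"
proof -
  have main: "prob (occ x \<inter> occ y) \<le> p * \<gamma> ^ min (nat \<bar>y $ i - x $ i\<bar>) (n + 1)"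
    if le: "x $ i \<le> y $ i" for x y
  proof -
    define j where "j = y $ i - x $ i"
    \<comment> \<open>The site at offset t from y leaves the cube at x as soon as y $ i + t > x $ i
      + n, that is t \<ge> n + 1 - j.\<close>
    define T where "T = {max 0 (int n + 1 - j)..int n}"
    define V where "V = (\<lambda>t. y + axis i t) ` T"
    have inj: "inj_on (\<lambda>t. y + axis i t) T" by (auto simp: inj_on_def axis_eq_axis)
    have cV: "card V = min (nat \<bar>y $ i - x $ i\<bar>) (n + 1)"
      unfolding V_def card_image[OF inj] using le by (auto simp: T_def j_def)
    have "sites {x} \<subseteq> - V"
    proof
      fix v assume "v \<in> sites {x}"
      then have "v $ i \<le> x $ i + int n" by (auto simp: sites_def cube_def)
      then show "v \<in> - V" by (auto simp: V_def T_def j_def)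
    qed
    then have "occ x \<in> sets (coord_algebra (- V))"
      using occ_local[of x "{x}"] coord_algebra_mono by blast
    then have *: "prob (occ x \<inter> {\<sigma>. \<forall>v\<in>V. \<sigma> v = A (v - y)}) \<le> \<gamma> ^ card V * prob (occ x)"
      by (intro energy) (auto simp: V_def T_def)
    have "axis i t \<in> cube n" if "t \<in> T" for t
      using that by (auto simp: cube_def axis_def T_def)
    then have "occ y \<subseteq> {\<sigma>. \<forall>v\<in>V. \<sigma> v = A (v - y)}"
      by (auto simp: occ_def V_def)
    moreover have "{\<sigma>. \<forall>v\<in>V. \<sigma> v = A (v - y)} \<in> events"
      using local_pattern_event[of V "\<lambda>x. x" UNIV "\<lambda>v. A (v - y)"] local_event
      by (auto simp: V_def T_def)
    ultimately have "prob (occ x \<inter> occ y) \<le> prob (occ x \<inter> {\<sigma>. \<forall>v\<in>V. \<sigma> v = A (v - y)})"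
      by (intro finite_measure_mono) auto
    then show ?thesis using * by (simp add: cV prob_occ mult.commute)
  qed
  show ?thesis
  proof (cases "x $ i \<le> y $ i")
    case False
    then show ?thesis using main[of y x] by (simp add: Int_commute abs_minus_commute)
  qed (rule main)
qed

lemma pair_mixing:
  fixes x y :: "'d site"
  assumes "\<bar>y $ i - x $ i\<bar> > int n"
  shows "prob (occ x \<inter> occ y) \<le> p * (p + real ((n + 1) ^ CARD('d)) * (C1 * exp (- C2 * (real_of_int \<bar>y $ i - x $ i\<bar> - real n))))"
proof -
  let ?e = "C1 * exp (- C2 * (real_of_int \<bar>y $ i - x $ i\<bar> - real n))"
  have "\<bar>prob (occ x \<inter> occ y) - prob (occ x) * prob (occ y)\<bar> \<le> real (card (sites {x})) * ?e * prob (occ y)"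
    by (rule local_mixing[of "{x}" "{y}"])
      (use assms in \<open>auto simp: separated_def abs_minus_commute intro!: occ_local exI[of _ i]\<close>)
  also have "\<dots> \<le> real ((n + 1) ^ CARD('d)) * ?e * p"
  proof -
    have "real (card (sites {x})) \<le> real ((n + 1) ^ CARD('d))"
      using card_sites_le[of "{x}"] by (simp only: of_nat_le_iff) simp
    then show ?thesis using C1_pos p_pos by (simp add: prob_occ)
  qed
  finally show ?thesis unfolding prob_occ by (simp add: algebra_simps abs_le_iff)
qed

text \<open>Neither estimate suffices alone: finite energy saturates at
  \<open>\<gamma> ^ (n + 1)\<close>, and mixing needs a distance beyond n and pays a volume factor.
  Switching at distance 2 * (n + 1) gives a decay that is uniform in n and in the pattern.\<close>

lemma pair_bound:
  "prob (occ x \<inter> occ y) \<le> p * (p + decay_const * exp (- decay_rate * real_of_int (l1 (y - x))))"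
proof -
  define J where "J = Max (range (\<lambda>i. \<bar>y $ i - x $ i\<bar>))"
  have "J \<in> range (\<lambda>i. \<bar>y $ i - x $ i\<bar>)" unfolding J_def by (rule Max_in) auto
  then obtain i where i: "J = \<bar>y $ i - x $ i\<bar>" by auto
  have le: "\<bar>y $ k - x $ k\<bar> \<le> J" for k unfolding J_def by (rule Max_ge) auto
  define d where "d = real CARD('d)"
  define \<kappa> where "\<kappa> = min (ln (1 / \<gamma>) / 2) (C2 / 4)"
  have d: "d > 0" by (simp add: d_def)
  have rate: "decay_rate = \<kappa> / d" by (simp add: decay_rate_def \<kappa>_def d_def)
  have \<kappa>: "\<kappa> > 0" using C2_pos \<gamma>_pos \<gamma>_less_1 by (simp add: \<kappa>_def)
  have "l1 (y - x) \<le> int CARD('d) * J"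
    unfolding l1_def using sum_bounded_above[of UNIV "\<lambda>i. \<bar>(y - x) $ i\<bar>" J] le by simp
  then have "real_of_int (l1 (y - x)) \<le> d * real_of_int J"
    unfolding d_def by (metis of_int_le_iff of_int_mult of_int_of_nat_eq)
  then have "\<kappa> / d * real_of_int (l1 (y - x)) \<le> \<kappa> / d * (d * real_of_int J)"
    using \<kappa> d by (intro mult_left_mono) auto
  then have ex: "exp (- \<kappa> * real_of_int J) \<le> exp (- decay_rate * real_of_int (l1 (y - x)))"
    using d by (simp add: rate)
  have J0: "J \<ge> 0" using i by simp
  have "prob (occ x \<inter> occ y) \<le> p * (p + decay_const * exp (- \<kappa> * real_of_int J))"
  \<comment> \<open>Up to this distance min J (n + 1) is at least J / 2.\<close>
  proof (cases "J \<le> 2 * (int n + 1)")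
    case True
    define k where "k = min (nat J) (n + 1)"
    have k: "real_of_int J / 2 \<le> real k" using True J0 by (auto simp: k_def min_def)
    have "\<gamma> ^ k = exp (- ln (1 / \<gamma>) * real k)"
      using \<gamma>_pos by (simp add: exp_of_nat2_mult ln_div)
    also have "\<dots> \<le> exp (- \<kappa> * real_of_int J)"
    proof -
      have "\<kappa> * real_of_int J \<le> ln (1 / \<gamma>) / 2 * real_of_int J"
        using J0 by (intro mult_right_mono) (auto simp: \<kappa>_def)
      also have "\<dots> \<le> ln (1 / \<gamma>) * real k"
        using k \<gamma>_pos \<gamma>_less_1 by (simp add: mult_left_mono[of "real_of_int J / 2" "real k" "ln (1 / \<gamma>)", simplified])
      finally show ?thesis by simp
    qed
    also have "\<dots> \<le> decay_const * exp (- \<kappa> * real_of_int J)" using decay_const_ge_1 by simp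
    finally have "p * \<gamma> ^ k \<le> p * (p + decay_const * exp (- \<kappa> * real_of_int J))"
      using p_pos by (intro mult_left_mono) auto
    then show ?thesis using pair_energy[of x y i] by (simp add: i k_def)
  next
    case False
    define r where "r = real_of_int J"
    have r: "real n + 1 \<le> r / 2" "r \<ge> 0" using False J0 by (auto simp: r_def)
    \<comment> \<open>At least half of the distance is left after subtracting n. The exponent C2 * r
      / 2 is split into equal parts, one to absorb (n + 1)^d and one to provide the decay.\<close>
    have "exp (- C2 * (r - real n)) \<le> exp (- C2 * (r / 2))"
      using r C2_pos by (simp add: mult_left_mono)
    also have "\<dots> = exp (- (C2 / 4 * r)) * exp (- (C2 / 4 * r))" by (simp add: exp_add[symmetric])
    finally have e1: "exp (- C2 * (r - real n)) \<le> exp (- (C2 / 4 * r)) * exp (- (C2 / 4 * r))" .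
    have "(C2 / 4 * r) ^ CARD('d) \<le> fact CARD('d) * exp (C2 / 4 * r)"
      by (rule power_le_fact_exp) (use r C2_pos in auto)
    then have "(4 / C2) ^ CARD('d) * (C2 / 4 * r) ^ CARD('d) \<le> (4 / C2) ^ CARD('d) * (fact CARD('d) * exp (C2 / 4 * r))"
      using C2_pos by (intro mult_left_mono) auto
    moreover have "(4 / C2) ^ CARD('d) * (C2 / 4 * r) ^ CARD('d) = r ^ CARD('d)"
      using C2_pos by (simp add: power_mult_distrib[symmetric])
    moreover have "real ((n + 1) ^ CARD('d)) \<le> r ^ CARD('d)"
      using r by (simp add: power_mono)
    ultimately have e2: "real ((n + 1) ^ CARD('d)) \<le> (fact CARD('d) * (4 / C2) ^ CARD('d)) * exp (C2 / 4 * r)"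
      by (simp only: mult.assoc mult.left_commute)
    have "real ((n + 1) ^ CARD('d)) * exp (- C2 * (r - real n))
        \<le> (fact CARD('d) * (4 / C2) ^ CARD('d) * exp (C2 / 4 * r)) * (exp (- (C2 / 4 * r)) * exp (- (C2 / 4 * r)))"
      by (rule mult_mono[OF e2 e1]) (use C2_pos in auto)
    also have "\<dots> = fact CARD('d) * (4 / C2) ^ CARD('d) * exp (- (C2 / 4 * r))"
      by (simp add: exp_minus field_simps)
    also have "\<dots> \<le> fact CARD('d) * (4 / C2) ^ CARD('d) * exp (- \<kappa> * r)"
      using r C2_pos by (intro mult_left_mono) (auto simp: \<kappa>_def intro!: mult_right_mono)
    finally have "C1 * (real ((n + 1) ^ CARD('d)) * exp (- C2 * (r - real n)))
        \<le> C1 * (fact CARD('d) * (4 / C2) ^ CARD('d) * exp (- \<kappa> * r))"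
      using C1_pos by (intro mult_left_mono) auto
    also have "\<dots> \<le> decay_const * exp (- \<kappa> * r)"
      by (simp add: decay_const_def algebra_simps)
    finally have "p * (p + real ((n + 1) ^ CARD('d)) * (C1 * exp (- C2 * (r - real n))))
        \<le> p * (p + decay_const * exp (- \<kappa> * r))"
      using p_pos by (intro mult_left_mono add_left_mono) (auto simp: algebra_simps)
    moreover have "\<bar>y $ i - x $ i\<bar> > int n" using False i by simp
    ultimately show ?thesis using pair_mixing[where x = x and y = y and i = i] by (simp add: r_def i)
  qed
  also have "\<dots> \<le> p * (p + decay_const * exp (- decay_rate * real_of_int (l1 (y - x))))"
    using ex p_pos decay_const_ge_1 by (intro mult_left_mono add_left_mono) auto
  finally show ?thesis .
qed

text \<open>The decaying part of \<open>pair_bound\<close> sums to a constant over the whole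
  lattice, however large V is. Given one occurrence, only boundedly many more are expected beyond
  the independent share.\<close>

lemma sum_pair_bound:
  assumes "finite V"
  shows "(\<Sum>y\<in>V. prob (occ x \<inter> occ y)) \<le> p * (real (card V) * p + (cluster_const - 1))"
proof -
  define g where "g = (\<lambda>j :: int. exp (- decay_rate * \<bar>real_of_int j\<bar>))"
  \<comment> \<open>Any radius with V - x inside the box [-m, m]^d will do; a sum of distances needs
    no case distinction for empty V.\<close>
  define m where "m = (\<Sum>y\<in>V. nat (l1 (y - x)))"
  define Z where "Z = {z :: 'd site. \<forall>i. z $ i \<in> {- int m..int m}}"
  have e: "exp (- decay_rate * real_of_int (l1 z)) = (\<Prod>i\<in>UNIV. g (z $ i))" for z :: "'d site"
    unfolding g_def by (simp add: exp_sum[symmetric] l1_def sum_distrib_left)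
  have sub: "(\<lambda>y. y - x) ` V \<subseteq> Z"
  proof safe
    fix y assume y: "y \<in> V"
    have "nat (l1 (y - x)) \<le> m" unfolding m_def by (rule member_le_sum[OF y _ assms]) simp
    then have "(y - x) $ i \<in> {- int m..int m}" for i
      using abs_coord_le_l1[of "y - x" i] by (simp only: atLeastAtMost_iff) linarith
    then show "y - x \<in> Z" unfolding Z_def by blast
  qed
  have "(\<Sum>y\<in>V. exp (- decay_rate * real_of_int (l1 (y - x)))) = (\<Sum>z\<in>(\<lambda>y. y - x) ` V. \<Prod>i\<in>UNIV. g (z $ i))"
    by (subst sum.reindex) (simp_all add: inj_on_def e[simplified])
  also have "\<dots> \<le> (\<Sum>z\<in>Z. \<Prod>i\<in>UNIV. g (z $ i))"
  proof (rule sum_mono2[OF _ sub])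
    show "finite Z" unfolding Z_def by (rule finite_vec_box) simp
  qed (auto simp: g_def intro!: prod_nonneg)
  also have "\<dots> = (\<Sum>j\<in>{- int m..int m}. g j) ^ CARD('d)"
    unfolding Z_def by (rule sum_prod_vec_box) simp
  also have "\<dots> \<le> (2 / (1 - exp (- decay_rate))) ^ CARD('d)"
    unfolding g_def by (intro power_mono sum_exp_abs_le decay_rate_pos sum_nonneg) simp
  finally have *: "(\<Sum>y\<in>V. exp (- decay_rate * real_of_int (l1 (y - x)))) \<le> (2 / (1 - exp (- decay_rate))) ^ CARD('d)" .
  have "(\<Sum>y\<in>V. prob (occ x \<inter> occ y)) \<le> (\<Sum>y\<in>V. p * (p + decay_const * exp (- decay_rate * real_of_int (l1 (y - x)))))"
    by (rule sum_mono) (rule pair_bound)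
  also have "\<dots> = p * (real (card V) * p + decay_const * (\<Sum>y\<in>V. exp (- decay_rate * real_of_int (l1 (y - x)))))"
    by (simp add: sum_distrib_left sum.distrib distrib_left mult_ac)
  also have "\<dots> \<le> p * (real (card V) * p + (cluster_const - 1))"
    using * p_pos decay_const_ge_1 by (simp add: cluster_const_def mult_left_mono)
  finally show ?thesis .
qed

text \<open>Second moment method: if \<open>N\<close> counts the occurrences in \<open>V\<close>, then
  \<open>2aN - a\<^sup>2N\<^sup>2\<close> is at most the indicator of \<open>N \<ge> 1\<close>, for every \<open>a\<close>.\<close>

lemma hitting_lower_bound:
  assumes V: "finite V" and small: "real (card V) * p \<le> 1"
  shows "real (card V) * p / (2 * cluster_const) \<le> 1 - q V"
proof -
  let ?K = "cluster_const"
  \<comment> \<open>With this value 2 * a * m - a^2 * m * K equals 3 * m / (4 * K).\<close>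
  define a where "a = 1 / (2 * ?K)"
  define m where "m = real (card V) * p"
  have K: "?K \<ge> 1" by (rule cluster_const_ge_1)
  have m: "0 \<le> m" "m \<le> 1" using small p_pos by (auto simp: m_def)
  define N where "N = (\<lambda>\<sigma>. \<Sum>x\<in>V. indicator (occ x) \<sigma> :: real)"
  have N2: "N \<sigma> * N \<sigma> = (\<Sum>x\<in>V. \<Sum>y\<in>V. indicator (occ x \<inter> occ y) \<sigma>)" for \<sigma>
    by (simp add: N_def sum_product indicator_inter_arith)
  have ii: "integrable P (indicator E :: _ \<Rightarrow> real)" if "E \<in> events" for E
    using that by (simp add: integrable_indicator_iff emeasure_eq_measure)
  have intN: "integrable P N" unfolding N_def by (intro Bochner_Integration.integrable_sum ii occ_event)
  have intN2: "integrable P (\<lambda>\<sigma>. N \<sigma> * N \<sigma>)"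
    unfolding N2 by (intro Bochner_Integration.integrable_sum ii) simp
  have EN: "expectation N = m"
    unfolding N_def m_def by (subst Bochner_Integration.integral_sum) (auto intro!: ii simp: prob_occ)
  have "expectation (\<lambda>\<sigma>. N \<sigma> * N \<sigma>) = (\<Sum>x\<in>V. \<Sum>y\<in>V. prob (occ x \<inter> occ y))"
    unfolding N2 by (simp add: Bochner_Integration.integral_sum Bochner_Integration.integrable_sum ii)
  also have "\<dots> \<le> (\<Sum>x\<in>V. p * (m + (?K - 1)))"
    unfolding m_def by (rule sum_mono) (rule sum_pair_bound[OF V])
  also have "\<dots> = m * (m + (?K - 1))" by (simp add: m_def)
  also have "\<dots> \<le> m * ?K" using m by (intro mult_left_mono) auto
  finally have EN2: "expectation (\<lambda>\<sigma>. N \<sigma> * N \<sigma>) \<le> m * ?K" .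
  have hit: "- avoid V \<in> events" using avoid_local[OF V] coord_algebra_Compl local_event by blast
  have le: "2 * a * N \<sigma> - a\<^sup>2 * (N \<sigma> * N \<sigma>) \<le> indicator (- avoid V) \<sigma>" for \<sigma>
  proof (cases "\<sigma> \<in> avoid V")
    case True
    then have "N \<sigma> = 0" by (auto simp: N_def avoid_def)
    then show ?thesis by simp
  next
    case False
    have "0 \<le> (1 - a * N \<sigma>)\<^sup>2" by simp
    then show ?thesis using False by (simp add: power2_eq_square algebra_simps)
  qed
  have "2 * a * m - a\<^sup>2 * (m * ?K) \<le> 2 * a * expectation N - a\<^sup>2 * expectation (\<lambda>\<sigma>. N \<sigma> * N \<sigma>)"
    using EN2 by (simp add: EN mult_left_mono)
  also have "\<dots> = expectation (\<lambda>\<sigma>. 2 * a * N \<sigma> - a\<^sup>2 * (N \<sigma> * N \<sigma>))"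
    using intN intN2 by (simp del: mult.assoc)
  also have "\<dots> \<le> expectation (indicator (- avoid V))"
    by (rule integral_mono) (use intN intN2 ii hit le in auto)
  also have "\<dots> = 1 - q V"
    using hit prob_compl[OF avoid_event[OF V]] by (simp add: q_def Compl_eq_Diff_UNIV)
  finally have "2 * a * m - a\<^sup>2 * (m * ?K) \<le> 1 - q V" .
  moreover have "m / (2 * ?K) \<le> 2 * a * m - a\<^sup>2 * (m * ?K)"
    using m K by (simp add: a_def power2_eq_square field_simps)
  ultimately show ?thesis by (simp add: m_def)
qed

end

section \<open>Approximate independence of boxes\<close>

text \<open>The first assumption makes the gap wider than a pattern; the second leaves room for a
  rim of width L on both sides of a box in every direction.\<close>

locale box_scheme = pattern_field P C1 C2 \<gamma> n A
  for P :: "('d::finite, 'a::finite) config measure" and C1 C2 \<gamma> :: real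
    and n :: nat and A :: "('d, 'a) config" +
  fixes f L :: nat
  assumes n_less_L: "n < L" and L_le_f: "2 * L \<le> f"
begin

definition box :: "'d site \<Rightarrow> 'd site set" where
  "box b = {x. \<forall>i. x $ i \<in> {int f * b $ i..<int f * b $ i + int f}}"

text \<open>The gap for mixing is kept inside the box, so that the boxes tile the lattice and cover
  a cube without holes.\<close>

definition core :: "'d site \<Rightarrow> 'd site set" where
  "core b = {x. \<forall>i. x $ i \<in> {int f * b $ i + int L..<int f * b $ i + int f - int L}}"

definition boxes :: "'d site set \<Rightarrow> 'd site set" where
  "boxes I = (\<Union>b\<in>I. box b)"

definition near :: "'d site \<Rightarrow> 'd site set" where
  "near b = {b'. \<forall>i. b' $ i \<in> {b $ i - 1..b $ i + 1}}"

text \<open>The relative error of \<open>q_mixing\<close> for subsets of one box: (f + n)^d bounds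
  the number of sites that their occurrences read.\<close>

definition mix_err :: real where
  "mix_err = real ((f + n) ^ CARD('d)) * (C1 * exp (- C2 * (real L - real n)))"

text \<open>A bound for the factor by which \<open>q (boxes I)\<close> grows when the neighbours of a box are deleted
  from \<open>I\<close>.\<close>

definition near_factor :: real where
  "near_factor = 2 ^ (3 ^ CARD('d))"

text \<open>The expected number of occurrences based in the rim of a box.\<close>

definition rim_mass :: real where
  "rim_mass = (real f ^ CARD('d) - real (f - 2 * L) ^ CARD('d)) * p"

text \<open>The relative error of adding one box. The core costs a mixing error; the rim costs its
  mass and another mixing error, times \<open>near_factor\<close> because the boxes around it have
  to be dropped first.\<close>

definition step_err :: real where
  "step_err = (near_factor + 1) * (rim_mass + mix_err)"

lemma f_pos: "0 < f"
  using n_less_L L_le_f by auto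

lemma finite_box: "finite (box b)"
  and card_box: "card (box b) = f ^ CARD('d)"
  and finite_core: "finite (core b)"
  and card_core: "card (core b) = (f - 2 * L) ^ CARD('d)"
proof -
  show "finite (box b)" "finite (core b)" unfolding box_def core_def by (intro finite_vec_box; simp)+
  show "card (box b) = f ^ CARD('d)" unfolding box_def card_vec_box by simp
  have "nat (int f * b $ i + int f - int L - (int f * b $ i + int L)) = f - 2 * L" for i by simp
  then show "card (core b) = (f - 2 * L) ^ CARD('d)" unfolding core_def card_vec_box by simp
qed

lemma core_subset: "core b \<subseteq> box b"
proof
  fix x assume x: "x \<in> core b"
  have "x $ i \<in> {int f * b $ i..<int f * b $ i + int f}" for i
    using x[unfolded core_def, simplified, rule_format, of i] by simp
  then show "x \<in> box b" unfolding box_def by blast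
qed

lemma finite_boxes: "finite I \<Longrightarrow> finite (boxes I)"
  by (simp add: boxes_def finite_box)

lemma finite_near: "finite (near b)" and card_near: "card (near b) = 3 ^ CARD('d)"
proof -
  show "finite (near b)" unfolding near_def by (rule finite_vec_box) simp
  have "nat (b $ i + 1 + 1 - (b $ i - 1)) = 3" for i by simp
  then show "card (near b) = 3 ^ CARD('d)" unfolding near_def card_vec_box by simp
qed

lemma mix_err_nonneg: "0 \<le> mix_err"
  using C1_pos by (simp add: mix_err_def)

lemma rim_mass_eq: "real (card (box b - core b)) * p = rim_mass"
proof -
  have "card (box b - core b) = f ^ CARD('d) - (f - 2 * L) ^ CARD('d)"
    by (simp add: card_Diff_subset finite_core core_subset card_box card_core)
  moreover have "(f - 2 * L) ^ CARD('d) \<le> f ^ CARD('d)" by (rule power_mono) auto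
  ultimately show ?thesis by (simp add: rim_mass_def of_nat_diff)
qed

lemma rim_mass_nonneg: "0 \<le> rim_mass"
  using rim_mass_eq[of 0] p_pos by (metis less_imp_le mult_nonneg_nonneg of_nat_0_le_iff)

lemma separated_boxes:
  assumes "b' \<notin> near b"
  shows "separated (int L) (box b) (box b')"
  unfolding separated_def
proof (intro ballI)
  fix x y assume x: "x \<in> box b" and y: "y \<in> box b'"
  obtain i where i: "b' $ i \<le> b $ i - 2 \<or> b' $ i \<ge> b $ i + 2"
  proof -
    from assms obtain i where "\<not> (b $ i - 1 \<le> b' $ i \<and> b' $ i \<le> b $ i + 1)"
      by (auto simp: near_def)
    then have "b' $ i \<le> b $ i - 2 \<or> b' $ i \<ge> b $ i + 2" by linarith
    then show thesis by (rule that)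
  qed
  have xi: "int f * b $ i \<le> x $ i" "x $ i < int f * b $ i + int f" using x by (auto simp: box_def)
  have yi: "int f * b' $ i \<le> y $ i" "y $ i < int f * b' $ i + int f" using y by (auto simp: box_def)
  from i have "int L \<le> \<bar>x $ i - y $ i\<bar>"
  proof
    assume "b' $ i \<le> b $ i - 2"
    then have "int f * b' $ i \<le> int f * (b $ i - 2)" by (intro mult_left_mono) auto
    then show ?thesis using xi yi L_le_f by (simp add: algebra_simps)
  next
    assume "b' $ i \<ge> b $ i + 2"
    then have "int f * (b $ i + 2) \<le> int f * b' $ i" by (intro mult_left_mono) auto
    then show ?thesis using xi yi L_le_f by (simp add: algebra_simps)
  qed
  then show "\<exists>i. int L \<le> \<bar>x $ i - y $ i\<bar>" ..
qed

lemma separated_core: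
  assumes "b' \<noteq> b"
  shows "separated (int L) (core b) (box b')"
  unfolding separated_def
proof (intro ballI)
  fix x y assume x: "x \<in> core b" and y: "y \<in> box b'"
  obtain i where i: "b' $ i \<le> b $ i - 1 \<or> b' $ i \<ge> b $ i + 1"
    using assms by (metis linorder_neqE zle_diff1_eq zless_imp_add1_zle vec_eq_iff)
  have xi: "int f * b $ i + int L \<le> x $ i" "x $ i < int f * b $ i + int f - int L"
    using x by (auto simp: core_def)
  have yi: "int f * b' $ i \<le> y $ i" "y $ i < int f * b' $ i + int f" using y by (auto simp: box_def)
  from i have "int L \<le> \<bar>x $ i - y $ i\<bar>"
  proof
    assume "b' $ i \<le> b $ i - 1"
    then have "int f * b' $ i \<le> int f * (b $ i - 1)" by (intro mult_left_mono) auto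
    then show ?thesis using xi yi by (simp add: algebra_simps)
  next
    assume "b' $ i \<ge> b $ i + 1"
    then have "int f * (b $ i + 1) \<le> int f * b' $ i" by (intro mult_left_mono) auto
    then show ?thesis using xi yi by (simp add: algebra_simps)
  qed
  then show "\<exists>i. int L \<le> \<bar>x $ i - y $ i\<bar>" ..
qed

lemma card_sites_box:
  assumes "T \<subseteq> box b"
  shows "card (sites T) \<le> (f + n) ^ CARD('d)"
proof -
  have sub: "sites T \<subseteq> {x. \<forall>i. x $ i \<in> {int f * b $ i..<int f * b $ i + int (f + n)}}"
  proof
    fix v assume "v \<in> sites T"
    then obtain x c where *: "x \<in> box b" "c \<in> cube n" "v = x + c"
      using assms by (auto simp: sites_def)
    have "v $ i \<in> {int f * b $ i..<int f * b $ i + int (f + n)}" for i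
    proof -
      have "x $ i \<in> {int f * b $ i..<int f * b $ i + int f}" "0 \<le> c $ i" "c $ i \<le> int n"
        using *(1,2) by (auto simp: box_def cube_def)
      then show ?thesis by (simp add: *(3))
    qed
    then show "v \<in> {x. \<forall>i. x $ i \<in> {int f * b $ i..<int f * b $ i + int (f + n)}}" by blast
  qed
  have "card (sites T) \<le> card {x :: 'd site. \<forall>i. x $ i \<in> {int f * b $ i..<int f * b $ i + int (f + n)}}"
    by (rule card_mono[OF _ sub]) (rule finite_vec_box, simp)
  also have "\<dots> = (f + n) ^ CARD('d)" unfolding card_vec_box by (simp add: nat_add_distrib)
  finally show ?thesis .
qed

lemma q_mixing_boxes:
  assumes "finite I" "T \<subseteq> box b" "\<And>c. c \<in> I \<Longrightarrow> separated (int L) T (box c)"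
  shows "\<bar>q (boxes I \<union> T) - q T * q (boxes I)\<bar> \<le> mix_err * q (boxes I)"
proof -
  have T: "finite T" using assms(2) finite_box finite_subset by blast
  have "separated (int L) T (boxes I)"
    using assms(3) by (auto simp: separated_def boxes_def)
  then have "\<bar>q (boxes I \<union> T) - q T * q (boxes I)\<bar>
      \<le> real (card (sites T)) * (C1 * exp (- C2 * (real L - real n))) * q (boxes I)"
    using q_mixing[OF T finite_boxes[OF assms(1)], of "int L"] n_less_L by simp
  also have "\<dots> \<le> mix_err * q (boxes I)"
    unfolding mix_err_def
    by (intro mult_right_mono q_nonneg of_nat_mono card_sites_box[OF assms(2)])
      (use C1_pos in auto)
  finally show ?thesis .
qed

lemma separated_mono: "separated l V W \<Longrightarrow> T \<subseteq> V \<Longrightarrow> separated l T W"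
  by (auto simp: separated_def)

text \<open>T may touch some of the boxes, so mixing does not apply directly. Submodularity permits
  forgetting the neighbours of b, after which T is separated from the rest; the price is that the
  loss is measured by the larger \<open>q (boxes (I - near b))\<close>.\<close>

lemma removal_far:
  assumes "finite I" "T \<subseteq> box b"
  shows "q (boxes I) - q (boxes I \<union> T) \<le> q (boxes (I - near b)) * (real (card T) * p + mix_err)"
proof -
  let ?J = "boxes (I - near b)"
  have T: "finite T" using assms(2) finite_box finite_subset by blast
  have "q (boxes I) - q (boxes I \<union> T) \<le> q ?J - q (?J \<union> T)"
    by (rule q_submodular[OF finite_boxes[OF assms(1)] T]) (auto simp: boxes_def)
  moreover have "\<bar>q (?J \<union> T) - q T * q ?J\<bar> \<le> mix_err * q ?J"
    using assms by (intro q_mixing_boxes) (auto intro: separated_mono[OF separated_boxes])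
  moreover have "q ?J * (1 - q T) \<le> q ?J * (real (card T) * p)"
    by (rule mult_left_mono[OF q_union_bound[OF T] q_nonneg])
  ultimately show ?thesis by (simp add: algebra_simps abs_le_iff)
qed

text \<open>The neighbours are put back one at a time, each at a factor 2. The assumption
  \<open>half\<close> concerns smaller families only, so that the induction hypothesis of
  \<open>q_boxes_half\<close> can supply it.\<close>

lemma near_removal:
  assumes "finite I"
    and half: "\<And>J c. finite J \<Longrightarrow> card J < card I \<Longrightarrow> q (boxes J) \<le> 2 * q (boxes J \<union> box c)"
  shows "q (boxes (I - near b)) \<le> near_factor * q (boxes I)"
proof -
  let ?J = "I - near b"
  have "q (boxes ?J) \<le> 2 ^ card F * q (boxes (?J \<union> F))" if "finite F" "F \<subseteq> I \<inter> near b" for F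
    using that
  proof (induction F)
    case (insert c F)
    \<comment> \<open>The index c of I is still missing from the family on the left.\<close>
    have "card (?J \<union> F) < card I"
      by (rule psubset_card_mono[OF assms(1)]) (use insert in blast)
    then have "q (boxes (?J \<union> F)) \<le> 2 * q (boxes (?J \<union> F) \<union> box c)"
      using assms(1) insert by (intro half) auto
    also have "boxes (?J \<union> F) \<union> box c = boxes (?J \<union> insert c F)" by (auto simp: boxes_def)
    finally have "2 ^ card F * q (boxes (?J \<union> F)) \<le> 2 ^ card F * (2 * q (boxes (?J \<union> insert c F)))"
      by (intro mult_left_mono) auto
    moreover have "q (boxes ?J) \<le> 2 ^ card F * q (boxes (?J \<union> F))"
      using insert by simp
    ultimately have "q (boxes ?J) \<le> 2 ^ card F * (2 * q (boxes (?J \<union> insert c F)))"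
      by (rule order.trans[rotated])
    then show ?case using insert.hyps by (simp add: mult.assoc mult.left_commute)
  qed simp
  from this[of "I \<inter> near b"] have "q (boxes ?J) \<le> 2 ^ card (I \<inter> near b) * q (boxes I)"
    using assms(1) by (simp add: Un_Diff_Int)
  also have "\<dots> \<le> near_factor * q (boxes I)"
    unfolding near_factor_def card_near[of b, symmetric]
    by (intro mult_right_mono power_increasing card_mono finite_near q_nonneg) auto
  finally show ?thesis .
qed

end

locale sparse_box_scheme = box_scheme P C1 C2 \<gamma> n A f L
  for P :: "('d::finite, 'a::finite) config measure" and C1 C2 \<gamma> :: real
    and n :: nat and A :: "('d, 'a) config" and f L :: nat +
  assumes sparse: "near_factor * (real (f ^ CARD('d)) * p + mix_err) \<le> 1 / 2"
begin

text \<open>The loss caused by one more box is relative to the family without neighbours; the claim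
  for smaller families compares that one with the full family, and \<open>sparse\<close> then makes
  the loss at most half.\<close>

lemma q_boxes_half: "finite I \<Longrightarrow> q (boxes I) \<le> 2 * q (boxes I \<union> box b)"
proof (induction "card I" arbitrary: I b rule: less_induct)
  case less
  have "q (boxes I) - q (boxes I \<union> box b)
      \<le> q (boxes (I - near b)) * (real (f ^ CARD('d)) * p + mix_err)"
    using removal_far[OF less.prems order.refl, of b] by (simp add: card_box)
  also have "\<dots> \<le> (near_factor * q (boxes I)) * (real (f ^ CARD('d)) * p + mix_err)"
    using less p_pos mix_err_nonneg by (intro mult_right_mono near_removal) auto
  also have "\<dots> = q (boxes I) * (near_factor * (real (f ^ CARD('d)) * p + mix_err))"
    by simp
  also have "\<dots> \<le> q (boxes I) * (1 / 2)"
    by (rule mult_left_mono[OF sparse q_nonneg])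
  finally show ?case by simp
qed

text \<open>Mixing applies to the core of the new box; the rim is treated as a loss. For the upper
  estimate only \<open>q (core b)\<close> has to be compared with \<open>q (box b)\<close>. For the
  lower one the loss must be relative to \<open>q (boxes I)\<close>, which is where
  \<open>removal_far\<close> and \<open>near_removal\<close> enter.\<close>

lemma q_boxes_step:
  assumes I: "finite I" and b: "b \<notin> I"
  shows "\<bar>q (boxes I \<union> box b) - q (box b) * q (boxes I)\<bar> \<le> step_err * q (boxes I)"
proof -
  let ?W = "boxes I" and ?T = "box b - core b"
  have K: "near_factor \<ge> 0" by (simp add: near_factor_def)
  have fW: "finite ?W" and fT: "finite ?T" by (simp_all add: finite_boxes finite_box I)
  have T: "real (card ?T) * p = rim_mass" by (rule rim_mass_eq)
  have Ub: "?W \<union> core b \<union> ?T = ?W \<union> box b" "core b \<union> ?T = box b" "{} \<union> ?T = ?T"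
    using core_subset by blast+
  have mc: "\<bar>q (?W \<union> core b) - q (core b) * q ?W\<bar> \<le> mix_err * q ?W"
    by (rule q_mixing_boxes[OF I core_subset separated_core]) (use b in auto)
  have "q (core b) - q (box b) \<le> q {} - q ({} \<union> ?T)"
    using q_submodular[OF finite_core fT empty_subsetI, of b] by (simp only: Ub)
  also have "\<dots> \<le> rim_mass" using q_union_bound[OF fT] by (simp add: T)
  finally have up: "q (core b) * q ?W \<le> (q (box b) + rim_mass) * q ?W"
    by (intro mult_right_mono q_nonneg) auto
  have "q (?W \<union> box b) \<le> q (?W \<union> core b)"
    using core_subset[of b] fW finite_box[of b] q_antimono[of "?W \<union> box b" "?W \<union> core b"] by auto
  then have upper: "q (?W \<union> box b) - q (box b) * q ?W \<le> (rim_mass + mix_err) * q ?W"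
    using mc up by (simp add: algebra_simps abs_le_iff)
  \<comment> \<open>Forgetting the core can only increase the loss caused by the rim.\<close>
  have "q (?W \<union> core b) - q (?W \<union> box b) \<le> q ?W - q (?W \<union> ?T)"
    using q_submodular[of "?W \<union> core b" ?T ?W] fW finite_core fT by (simp only: Ub) simp
  also have "\<dots> \<le> q (boxes (I - near b)) * (rim_mass + mix_err)"
    using removal_far[OF I, of ?T b] by (simp only: T) simp
  also have "\<dots> \<le> (near_factor * q ?W) * (rim_mass + mix_err)"
    using near_removal[OF I q_boxes_half] rim_mass_nonneg mix_err_nonneg
    by (intro mult_right_mono) auto
  finally have "q (?W \<union> core b) - q (?W \<union> box b) \<le> near_factor * q ?W * (rim_mass + mix_err)" .
  moreover have "q (box b) * q ?W \<le> q (core b) * q ?W"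
    by (intro mult_right_mono q_antimono finite_box core_subset q_nonneg)
  ultimately have "q (box b) * q ?W - q (?W \<union> box b) \<le> near_factor * q ?W * (rim_mass + mix_err) + mix_err * q ?W"
    using mc by (simp add: abs_le_iff)
  moreover have "mix_err * q ?W \<le> (rim_mass + mix_err) * q ?W"
    using rim_mass_nonneg by (intro mult_right_mono q_nonneg) auto
  ultimately have lower: "q (box b) * q ?W - q (?W \<union> box b) \<le> step_err * q ?W"
    by (simp add: step_err_def algebra_simps)
  have "0 \<le> near_factor * (rim_mass + mix_err) * q ?W"
    using K rim_mass_nonneg mix_err_nonneg q_nonneg by simp
  then have "(rim_mass + mix_err) * q ?W \<le> step_err * q ?W"
    by (simp add: step_err_def algebra_simps)
  with upper lower show ?thesis by (simp add: abs_le_iff)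
qed

lemma q_box: "q (box b) = q (box 0)"
proof -
  have "box b = (+) (\<chi> i. int f * b $ i) ` box 0"
  proof (intro set_eqI iffI)
    fix x assume "x \<in> box b"
    then have "x - (\<chi> i. int f * b $ i) \<in> box 0" by (auto simp: box_def algebra_simps)
    then show "x \<in> (+) (\<chi> i. int f * b $ i) ` box 0" by (intro image_eqI) auto
  qed (auto simp: box_def)
  then show ?thesis by (simp add: q_translate finite_box)
qed

lemma q_boxes_power:
  assumes "finite I" "step_err \<le> q (box 0)"
  shows "(q (box 0) - step_err) ^ card I \<le> q (boxes I)" "q (boxes I) \<le> (q (box 0) + step_err) ^ card I"
proof -
  have e: "0 \<le> step_err"
    using rim_mass_nonneg mix_err_nonneg by (simp add: step_err_def near_factor_def)
  from assms(1) have "(q (box 0) - step_err) ^ card I \<le> q (boxes I) \<and> q (boxes I) \<le> (q (box 0) + step_err) ^ card I"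
  proof (induction I)
    case empty
    then show ?case by (simp add: boxes_def)
  next
    case (insert b I)
    have eq: "boxes (insert b I) = boxes I \<union> box b" by (auto simp: boxes_def)
    have *: "\<bar>q (boxes (insert b I)) - q (box 0) * q (boxes I)\<bar> \<le> step_err * q (boxes I)"
      unfolding eq using q_boxes_step[OF insert.hyps] by (simp add: q_box[of b])
    have "(q (box 0) - step_err) * (q (box 0) - step_err) ^ card I \<le> (q (box 0) - step_err) * q (boxes I)"
      using insert.IH assms(2) by (intro mult_left_mono) auto
    moreover have "(q (box 0) + step_err) * q (boxes I) \<le> (q (box 0) + step_err) * (q (box 0) + step_err) ^ card I"
      using insert.IH e q_nonneg[of "box 0"] by (intro mult_left_mono) auto
    ultimately show ?case using * insert.hyps by (simp add: algebra_simps abs_le_iff)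
  qed
  then show "(q (box 0) - step_err) ^ card I \<le> q (boxes I)" "q (boxes I) \<le> (q (box 0) + step_err) ^ card I"
    by auto
qed

end

section \<open>Comparison of exponentials\<close>

lemma power_diff_le:
  fixes a b :: real
  assumes "0 \<le> a" "a \<le> b"
  shows "b ^ k - a ^ k \<le> real k * (b - a) * b ^ (k - 1)"
proof (induction k)
  case (Suc k)
  have "b ^ Suc k - a ^ Suc k = b * (b ^ k - a ^ k) + (b - a) * a ^ k"
    by (simp add: algebra_simps)
  also have "\<dots> \<le> b * (real k * (b - a) * b ^ (k - 1)) + (b - a) * b ^ k"
    using assms Suc by (intro add_mono mult_left_mono power_mono) auto
  also have "\<dots> = real (Suc k) * (b - a) * b ^ k"
    by (cases k) (simp_all add: algebra_simps)
  finally show ?case by simp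
qed simp

lemma one_plus_power_le:
  fixes v :: real
  assumes "0 \<le> v"
  shows "(1 + v) ^ k \<le> 2 ^ k * (1 + v ^ k)"
proof -
  have "(1 + v) ^ k \<le> (2 * max 1 v) ^ k" using assms by (intro power_mono) auto
  also have "\<dots> = 2 ^ k * max 1 v ^ k" by (simp add: power_mult_distrib)
  also have "max 1 v ^ k \<le> 1 + v ^ k" using assms by (auto simp: max_def)
  finally show ?thesis by simp
qed

lemma exp_minus_diff_le: "exp (- x) - exp (- y) \<le> (y - x) * exp (- x :: real)"
proof -
  have "exp (- x) * (1 - exp (x - y)) \<le> exp (- x) * (y - x)"
  proof (rule mult_left_mono)
    show "1 - exp (x - y) \<le> y - x" using exp_ge_add_one_self[of "x - y"] by linarith
  qed simp
  then show ?thesis by (simp add: algebra_simps exp_add[symmetric])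
qed

text \<open>For v at least 4 already v - 2 \<ge> v / 2, and for smaller v the left side is not
  positive. So losing two layers costs a constant in the exponent and a factor 2^k in the
  rate.\<close>

lemma shifted_power_ge:
  fixes v :: real
  assumes "0 \<le> v" "w \<ge> v - 2" "w \<ge> 0"
  shows "(v / 2) ^ k - 2 ^ k \<le> w ^ k"
proof (cases "v \<ge> 4")
  case True
  then have "(v / 2) ^ k \<le> w ^ k" using assms by (intro power_mono) auto
  moreover have "0 \<le> (2 :: real) ^ k" by simp
  ultimately show ?thesis by linarith
next
  case False
  then have "(v / 2) ^ k \<le> 2 ^ k" using assms by (intro power_mono) auto
  then show ?thesis using assms by (smt (verit) zero_le_power)
qed

definition tail_const :: "nat \<Rightarrow> real" where
  "tail_const k = (1 + 2 * real k) * 2 ^ k * exp (2 ^ k) * 2 ^ (k + 2)"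

text \<open>A factor 1 / 2 comes from 1 - \<eta>, a factor 1 / 2^k from
  \<open>shifted_power_ge\<close>, and a last 1 / 2 is spent on absorbing 1 + v^k.\<close>

definition tail_rate :: "nat \<Rightarrow> real" where
  "tail_rate k = 1 / 2 ^ (k + 2)"

text \<open>In the application v^k is the time t, \<eta> the relative error of the rate per box, and
  r the width of a box in the scale of v. Both exponents differ from t by a small multiple of (1 +
  v)^k, and part of the decay is given up to absorb this polynomial.\<close>

lemma exp_approximation:
  fixes v r \<eta> X :: real
  assumes v: "0 \<le> v" and r: "0 \<le> r" "r \<le> 1" and \<eta>: "0 \<le> \<eta>" "\<eta> \<le> 1 / 2"
    and lower: "exp (- ((1 + \<eta>) * (v + r) ^ k)) \<le> X"
    and upper: "X \<le> exp (- ((1 - \<eta>) * max 0 (v - 2 * r) ^ k))"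
  shows "\<bar>X - exp (- (v ^ k))\<bar> \<le> tail_const k * (\<eta> + r) * exp (- tail_rate k * v ^ k)"
proof -
  \<comment> \<open>Dominates the error in both exponents; the 2 reflects the shift by 2 * r in
    \<open>upper\<close>.\<close>
  define B where "B = (\<eta> + 2 * real k * r) * (1 + v) ^ k"
  define c where "c = 1 / (2 :: real) ^ (k + 1)"
  let ?t = "v ^ k"
  have t: "0 \<le> ?t" using v by simp
  have c: "0 < c" "c \<le> 1"
    using one_le_power[of "2 :: real" "k + 1"] by (auto simp: c_def divide_le_eq simp del: power_Suc)
  have incr: "y ^ k - x ^ k \<le> real k * (y - x) * (1 + v) ^ k" if "0 \<le> x" "x \<le> y" "y \<le> 1 + v" for x y
  proof -
    have "y ^ (k - 1) \<le> (1 + v) ^ (k - 1)" using that by (intro power_mono) auto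
    also have "\<dots> \<le> (1 + v) ^ k" using v by (intro power_increasing) auto
    finally have "real k * (y - x) * y ^ (k - 1) \<le> real k * (y - x) * (1 + v) ^ k"
      using that by (intro mult_left_mono) auto
    then show ?thesis using power_diff_le[OF that(1,2), of k] by linarith
  qed
  have pw: "y ^ k \<le> (1 + v) ^ k" if "0 \<le> y" "y \<le> 1 + v" for y
    using that by (rule power_mono[rotated])
  have B0: "0 \<le> B" using v r \<eta> by (simp add: B_def)
  have "exp (- ?t) - X \<le> exp (- ?t) - exp (- ((1 + \<eta>) * (v + r) ^ k))" using lower by simp
  also have "\<dots> \<le> ((1 + \<eta>) * (v + r) ^ k - ?t) * exp (- ?t)" by (rule exp_minus_diff_le)
  also have "\<dots> \<le> B * exp (- ?t)"
  proof (rule mult_right_mono)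
    have "(v + r) ^ k - v ^ k \<le> real k * (v + r - v) * (1 + v) ^ k" by (rule incr) (use v r in auto)
    moreover have "\<eta> * (v + r) ^ k \<le> \<eta> * (1 + v) ^ k"
      by (rule mult_left_mono[OF pw]) (use v r \<eta> in auto)
    moreover have "0 \<le> real k * r * (1 + v) ^ k" using v r by simp
    ultimately show "(1 + \<eta>) * (v + r) ^ k - ?t \<le> B" by (simp add: B_def algebra_simps)
  qed simp
  also have "\<dots> \<le> B * (exp (2 ^ k) * exp (- c * ?t))"
  proof (rule mult_left_mono[OF _ B0])
    have "c * ?t \<le> 1 * ?t" using c t by (intro mult_right_mono) auto
    moreover have "0 \<le> (2 :: real) ^ k" by simp
    ultimately have "- ?t \<le> 2 ^ k + - c * ?t" by linarith
    then show "exp (- ?t) \<le> exp (2 ^ k) * exp (- c * ?t)" by (simp add: exp_add[symmetric])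
  qed
  finally have 1: "exp (- ?t) - X \<le> B * (exp (2 ^ k) * exp (- c * ?t))" .
  let ?w = "max 0 (v - 2 * r)"
  have "X - exp (- ?t) \<le> exp (- ((1 - \<eta>) * ?w ^ k)) - exp (- ?t)" using upper by simp
  also have "\<dots> \<le> (?t - (1 - \<eta>) * ?w ^ k) * exp (- ((1 - \<eta>) * ?w ^ k))" by (rule exp_minus_diff_le)
  also have "\<dots> \<le> B * exp (- ((1 - \<eta>) * ?w ^ k))"
  proof (rule mult_right_mono)
    have "v ^ k - ?w ^ k \<le> real k * (v - ?w) * (1 + v) ^ k" by (rule incr) (use v r in auto)
    also have "\<dots> \<le> real k * (2 * r) * (1 + v) ^ k"
      using v r by (intro mult_right_mono mult_left_mono) auto
    finally have "v ^ k - ?w ^ k \<le> real k * (2 * r) * (1 + v) ^ k" .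
    moreover have "\<eta> * ?w ^ k \<le> \<eta> * (1 + v) ^ k"
      by (rule mult_left_mono[OF pw]) (use v r \<eta> in auto)
    ultimately show "?t - (1 - \<eta>) * ?w ^ k \<le> B" by (simp add: B_def algebra_simps)
  qed simp
  also have "\<dots> \<le> B * (exp (2 ^ k) * exp (- c * ?t))"
  proof (rule mult_left_mono[OF _ B0])
    have w: "(v / 2) ^ k - 2 ^ k \<le> ?w ^ k" by (rule shifted_power_ge) (use v r in auto)
    have "c * ?t - 2 ^ k \<le> 1 / 2 * ((v / 2) ^ k - 2 ^ k)" by (simp add: c_def power_divide)
    also have "\<dots> \<le> 1 / 2 * ?w ^ k" by (rule mult_left_mono[OF w]) simp
    also have "\<dots> \<le> (1 - \<eta>) * ?w ^ k" using \<eta> by (intro mult_right_mono) auto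
    finally show "exp (- ((1 - \<eta>) * ?w ^ k)) \<le> exp (2 ^ k) * exp (- c * ?t)"
      by (simp add: exp_add[symmetric])
  qed
  finally have 2: "X - exp (- ?t) \<le> B * (exp (2 ^ k) * exp (- c * ?t))" .
  have "(1 + ?t) * exp (- c * ?t) \<le> 2 ^ (k + 2) * exp (- tail_rate k * ?t)"
  proof -
    have rate: "c = 2 * tail_rate k" by (simp add: c_def tail_rate_def)
    have "1 + ?t \<le> 2 ^ (k + 2) * (1 + tail_rate k * ?t)"
      using one_le_power[of "2 :: real" "k + 2"] by (simp add: tail_rate_def algebra_simps del: power_Suc)
    also have "\<dots> \<le> 2 ^ (k + 2) * exp (tail_rate k * ?t)"
      using exp_ge_add_one_self by (intro mult_left_mono) auto
    finally have "(1 + ?t) * exp (- c * ?t) \<le> 2 ^ (k + 2) * exp (tail_rate k * ?t) * exp (- c * ?t)"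
      by (rule mult_right_mono) simp
    then show ?thesis by (simp add: rate mult.assoc exp_add[symmetric])
  qed
  moreover have "B \<le> ((1 + 2 * real k) * (\<eta> + r)) * (2 ^ k * (1 + ?t))"
    unfolding B_def using one_plus_power_le[OF v, of k] r \<eta> v
    by (intro mult_mono) (auto simp: algebra_simps)
  ultimately have "B * (exp (2 ^ k) * exp (- c * ?t)) \<le> tail_const k * (\<eta> + r) * exp (- tail_rate k * ?t)"
  proof -
    assume e: "(1 + ?t) * exp (- c * ?t) \<le> 2 ^ (k + 2) * exp (- tail_rate k * ?t)"
      and b: "B \<le> ((1 + 2 * real k) * (\<eta> + r)) * (2 ^ k * (1 + ?t))"
    have "B * (exp (2 ^ k) * exp (- c * ?t))
        \<le> ((1 + 2 * real k) * (\<eta> + r)) * (2 ^ k * (1 + ?t)) * (exp (2 ^ k) * exp (- c * ?t))"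
      by (rule mult_right_mono[OF b]) simp
    also have "\<dots> = ((1 + 2 * real k) * (\<eta> + r) * 2 ^ k * exp (2 ^ k)) * ((1 + ?t) * exp (- c * ?t))"
      by (simp only: mult_ac)
    also have "\<dots> \<le> ((1 + 2 * real k) * (\<eta> + r) * 2 ^ k * exp (2 ^ k)) * (2 ^ (k + 2) * exp (- tail_rate k * ?t))"
      by (rule mult_left_mono[OF e]) (use r \<eta> in auto)
    finally show ?thesis by (simp only: tail_const_def mult_ac)
  qed
  with 1 2 show ?thesis by (simp add: abs_le_iff)
qed

section \<open>First occurrence and avoided sets\<close>

lemma l1_pos_iff: "0 < l1 x \<longleftrightarrow> x \<noteq> 0"
proof
  show "x \<noteq> 0" if "0 < l1 x" using that by (auto simp: l1_def)
  assume "x \<noteq> 0"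
  then obtain i where "x $ i \<noteq> 0" by (auto simp: vec_eq_iff)
  then show "0 < l1 x" using abs_coord_le_l1[of x i] by linarith
qed

context pattern_field
begin

text \<open>Occurrence within k is monotone in the integer k, so a real bound may be replaced by its
  floor; the condition of positive norm takes the origin out of the cube.\<close>

lemma first_occurrence_event:
  assumes A: "A \<in> patterns (cube n)" and s: "0 \<le> s"
  shows "{\<sigma>. ereal_of_enat (first_occurrence n A \<sigma>) > ereal s} = avoid (cube (nat \<lfloor>s\<rfloor>) - {0})"
proof -
  have pat: "restrict (translate x \<sigma>) (cube n) = A \<longleftrightarrow> \<sigma> \<in> occ x" for x \<sigma>
  proof -
    have "restrict (translate x \<sigma>) (cube n) = A \<longleftrightarrow> (\<forall>c\<in>cube n. translate x \<sigma> c = A c)"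
      using A unfolding patterns_def by (metis PiE_restrict restrict_apply' restrict_ext)
    then show ?thesis by (simp add: occ_def translate_def)
  qed
  have ow: "occurs_within n A \<sigma> k \<longleftrightarrow> (\<exists>x\<in>cube k - {0}. \<sigma> \<in> occ x)" for \<sigma> k
    unfolding occurs_within_def pat l1_pos_iff by (auto simp: cube_def)
  have mono: "occurs_within n A \<sigma> k \<Longrightarrow> k \<le> k' \<Longrightarrow> occurs_within n A \<sigma> k'" for \<sigma> k k'
  proof -
    assume k: "occurs_within n A \<sigma> k" "k \<le> k'"
    have "int k \<le> int k'" using k(2) by simp
    then have "cube k \<subseteq> (cube k' :: 'd site set)"
      unfolding cube_def by (blast intro: order_trans)
    then show ?thesis using k(1) unfolding ow by blast
  qed
  have key: "ereal_of_enat (first_occurrence n A \<sigma>) > ereal s \<longleftrightarrow> \<not> occurs_within n A \<sigma> (nat \<lfloor>s\<rfloor>)" for \<sigma>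
  proof (cases "\<exists>k. occurs_within n A \<sigma> k")
    case True
    define l where "l = (LEAST k. occurs_within n A \<sigma> k)"
    have l: "occurs_within n A \<sigma> l" unfolding l_def using True by (rule LeastI_ex)
    have "occurs_within n A \<sigma> k \<longleftrightarrow> l \<le> k" for k
      using mono[OF l] Least_le[of "occurs_within n A \<sigma>" k] unfolding l_def[symmetric] by blast
    moreover have "ereal_of_enat (first_occurrence n A \<sigma>) = ereal (real l)"
      using True by (simp add: first_occurrence_def l_def)
    ultimately show ?thesis using s by (simp add: not_le nat_less_iff floor_less_iff)
  next
    case False
    then show ?thesis by (simp add: first_occurrence_def)
  qed
  show ?thesis unfolding key ow avoid_def by blast
qed

lemma prob_first_occurrence:
  assumes "A \<in> patterns (cube n)" "0 \<le> s"
  shows "prob {\<sigma>. ereal_of_enat (first_occurrence n A \<sigma>) > ereal s} = q (cube (nat \<lfloor>s\<rfloor>) - {0})"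
  by (simp add: first_occurrence_event[OF assms] q_def)

lemma p_eq_cylinder:
  assumes A: "A \<in> patterns (cube n)"
  shows "measure P (cylinder (cube n) A) = p"
proof -
  have "restrict \<sigma> (cube n) = A \<longleftrightarrow> (\<forall>c\<in>cube n. \<sigma> c = A c)" for \<sigma>
    using A unfolding patterns_def by (metis PiE_restrict restrict_apply' restrict_ext)
  then have "cylinder (cube n) A = occ 0" by (simp add: cylinder_def occ_def)
  then show ?thesis by (simp add: p_def)
qed

text \<open>At this spacing the mixing error is at most half of p, so avoiding a further point still
  costs a factor 1 - p / 2. This gives an exponential tail without any smallness of p.\<close>

lemma q_spread_points:
  assumes M: "n < M" and err: "real ((n + 1) ^ CARD('d)) * (C1 * exp (- C2 * (real M - real n))) \<le> p / 2"
    and I: "finite I"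
  shows "q ((\<lambda>b. \<chi> i. int M * b $ i) ` I) \<le> (1 - p / 2) ^ card I"
  using I
proof (induction I)
  case (insert b I)
  let ?g = "\<lambda>b :: 'd site. (\<chi> i. int M * b $ i) :: 'd site"
  let ?W = "?g ` I"
  have sep: "separated (int M) {?g b} ?W"
    unfolding separated_def
  proof (intro ballI)
    fix x y assume "x \<in> {?g b}" "y \<in> ?W"
    then obtain b' where b': "b' \<in> I" "x = ?g b" "y = ?g b'" by auto
    then obtain i where i: "b $ i \<noteq> b' $ i" using insert.hyps by (metis vec_eq_iff)
    have "int M * 1 \<le> int M * \<bar>b $ i - b' $ i\<bar>" using i by (intro mult_left_mono) auto
    also have "\<dots> = \<bar>x $ i - y $ i\<bar>"
    proof -
      have "x $ i - y $ i = int M * (b $ i - b' $ i)" using b' by (simp add: right_diff_distrib)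
      then show ?thesis by (simp only: abs_mult abs_of_nat)
    qed
    finally show "\<exists>i. int M \<le> \<bar>x $ i - y $ i\<bar>" by auto
  qed
  have q1: "q {?g b} = 1 - p"
    using prob_compl[OF occ_event, of "?g b"] by (simp add: q_def avoid_def prob_occ Compl_eq_Diff_UNIV)
  have "real (card (sites {?g b})) \<le> real ((n + 1) ^ CARD('d))"
    using card_sites_le[of "{?g b}"] by (intro of_nat_mono) simp
  then have "real (card (sites {?g b})) * (C1 * exp (- C2 * (real M - real n)))
      \<le> real ((n + 1) ^ CARD('d)) * (C1 * exp (- C2 * (real M - real n)))"
    using C1_pos by (intro mult_right_mono) auto
  with err have "real (card (sites {?g b})) * (C1 * exp (- C2 * (real M - real n))) \<le> p / 2" by linarith
  then have "real (card (sites {?g b})) * (C1 * exp (- C2 * (real M - real n))) * q ?W \<le> p / 2 * q ?W"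
    by (rule mult_right_mono[OF _ q_nonneg])
  moreover have "\<bar>q (?W \<union> {?g b}) - q {?g b} * q ?W\<bar>
      \<le> real (card (sites {?g b})) * (C1 * exp (- C2 * (real M - real n))) * q ?W"
    using q_mixing[OF _ _ sep] insert.hyps M by simp
  ultimately have "q (?W \<union> {?g b}) \<le> (1 - p / 2) * q ?W"
    unfolding q1 by (simp add: abs_le_iff algebra_simps)
  also have "\<dots> \<le> (1 - p / 2) * (1 - p / 2) ^ card I"
  proof (rule mult_left_mono[OF insert.IH])
    have "p \<le> 1" by (simp add: p_def)
    then show "0 \<le> 1 - p / 2" by linarith
  qed
  finally show ?case using insert.hyps by simp
qed simp

end

context sparse_box_scheme
begin

lemma first_passage_upper:
  assumes s: "0 \<le> s" and e: "step_err \<le> q (box 0)" and h: "0 \<le> h"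
    and up: "q (box 0) + step_err \<le> exp (- h)"
  shows "q (cube (nat \<lfloor>s\<rfloor>) - {0}) \<le> exp (- (h * max 0 (s / real f - 2) ^ CARD('d)))"
proof -
  define k where "k = nat \<lfloor>s\<rfloor>"
  define N where "N = (k + 1) div f"
  \<comment> \<open>N full boxes fit in each direction. The layers with index 0 are dropped to keep
    the origin out; together with the incomplete last box this explains s / f - 2.\<close>
  define I :: "'d site set" where "I = {b. \<forall>i. b $ i \<in> {1..int N - 1}}"
  have fI: "finite I" unfolding I_def by (rule finite_vec_box) simp
  have "nat (int N - 1) = N - 1" by simp
  then have cI: "card I = (N - 1) ^ CARD('d)" unfolding I_def card_vec_box by simp
  have "boxes I \<subseteq> cube k - {0}"
  proof
    fix x assume "x \<in> boxes I"
    then obtain b where b: "b \<in> I" "x \<in> box b" by (auto simp: boxes_def)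
    have "0 < x $ i \<and> x $ i \<le> int k" for i
    proof -
      have bi: "1 \<le> b $ i" "b $ i \<le> int N - 1" using b by (auto simp: I_def)
      have xi: "int f * b $ i \<le> x $ i" "x $ i < int f * b $ i + int f" using b by (auto simp: box_def)
      have "int f * 1 \<le> int f * b $ i" using bi by (intro mult_left_mono) auto
      moreover have "int f * b $ i + int f \<le> int k + 1"
      proof -
        have "int f * (b $ i + 1) \<le> int f * int N" using bi by (intro mult_left_mono) auto
        also have "\<dots> \<le> int (k + 1)"
          unfolding N_def of_nat_mult[symmetric] of_nat_le_iff by simp
        finally show ?thesis by (simp add: algebra_simps)
      qed
      ultimately show ?thesis using xi f_pos by linarith
    qed
    then show "x \<in> cube k - {0}" by (auto simp: cube_def less_le vec_eq_iff)
  qed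
  then have "q (cube k - {0}) \<le> q (boxes I)" by (intro q_antimono) (auto simp: finite_cube)
  also have "\<dots> \<le> (q (box 0) + step_err) ^ card I" by (rule q_boxes_power(2)[OF fI e])
  also have "\<dots> \<le> exp (- h) ^ card I"
  proof (rule power_mono[OF up])
    show "0 \<le> q (box 0) + step_err"
      using rim_mass_nonneg mix_err_nonneg q_nonneg[of "box 0"]
      by (simp add: step_err_def near_factor_def)
  qed
  also have "\<dots> = exp (- (h * real (N - 1) ^ CARD('d)))"
    by (simp add: cI exp_of_nat_mult[symmetric] mult.commute)
  also have "\<dots> \<le> exp (- (h * max 0 (s / real f - 2) ^ CARD('d)))"
  proof -
    have ks: "s \<le> real (k + 1)" using s real_of_int_floor_add_one_ge[of s] by (simp add: k_def add.commute)
    have "k + 1 < (N + 1) * f" unfolding N_def using f_pos by (simp add: dividend_less_div_times)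
    then have "real (k + 1) \<le> (real N + 1) * real f"
      by (metis less_imp_le of_nat_1 of_nat_add of_nat_le_iff of_nat_mult)
    then have "s / real f \<le> real N + 1" using ks f_pos by (simp add: divide_le_eq)
    then have "max 0 (s / real f - 2) \<le> real (N - 1)" by linarith
    then show ?thesis using h by (simp add: mult_left_mono power_mono)
  qed
  finally show ?thesis by (simp add: k_def)
qed

lemma first_passage_lower:
  assumes s: "0 \<le> s" and e: "step_err \<le> q (box 0)" and h: "0 \<le> h"
    and lo: "exp (- h) \<le> q (box 0) - step_err"
  shows "exp (- (h * (s / real f + 1) ^ CARD('d))) \<le> q (cube (nat \<lfloor>s\<rfloor>) - {0})"
proof -
  define k where "k = nat \<lfloor>s\<rfloor>"
  define N where "N = k div f"
  \<comment> \<open>Now a covering is wanted, so index 0 is included; covering the origin too only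
    lowers \<open>q\<close>.\<close>
  define I :: "'d site set" where "I = {b. \<forall>i. b $ i \<in> {0..int N}}"
  have fI: "finite I" unfolding I_def by (rule finite_vec_box) simp
  have cI: "card I = (N + 1) ^ CARD('d)" unfolding I_def card_vec_box by (simp add: nat_add_distrib)
  have "cube k - {0} \<subseteq> boxes I"
  proof
    fix x :: "'d site" assume "x \<in> cube k - {0}"
    then have x: "0 \<le> x $ i" "x $ i \<le> int k" for i by (auto simp: cube_def)
    define b :: "'d site" where "b = (\<chi> i. x $ i div int f)"
    have "b $ i \<in> {0..int N}" for i
      using x[of i] f_pos zdiv_mono1[of "x $ i" "int k" "int f"]
      by (simp add: b_def N_def zdiv_int pos_imp_zdiv_nonneg_iff)
    then have "b \<in> I" by (auto simp: I_def)
    moreover have "x $ i \<in> {int f * b $ i..<int f * b $ i + int f}" for i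
    proof -
      have "int f * (x $ i div int f) + x $ i mod int f = x $ i" by simp
      moreover have "0 \<le> x $ i mod int f" "x $ i mod int f < int f" using f_pos by simp_all
      ultimately have "int f * (x $ i div int f) \<le> x $ i"
        "x $ i < int f * (x $ i div int f) + int f" by linarith+
      then show ?thesis by (simp add: b_def)
    qed
    then have "x \<in> box b" unfolding box_def by blast
    ultimately show "x \<in> boxes I" by (auto simp: boxes_def)
  qed
  then have "q (boxes I) \<le> q (cube k - {0})" by (intro q_antimono finite_boxes fI)
  moreover have "(q (box 0) - step_err) ^ card I \<le> q (boxes I)" by (rule q_boxes_power(1)[OF fI e])
  moreover have "exp (- h) ^ card I \<le> (q (box 0) - step_err) ^ card I" by (rule power_mono[OF lo]) simp
  moreover have "exp (- h) ^ card I = exp (- (h * (real N + 1) ^ CARD('d)))"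
    by (simp add: cI exp_of_nat_mult[symmetric] mult.commute add.commute)
  moreover have "exp (- (h * (s / real f + 1) ^ CARD('d))) \<le> exp (- (h * (real N + 1) ^ CARD('d)))"
  proof -
    have "real k \<le> s" using s unfolding k_def by simp
    moreover have "real N \<le> real k / real f" 
    proof -
      have "N * f \<le> k" unfolding N_def by simp
      then have "real N * real f \<le> real k" by (metis of_nat_le_iff of_nat_mult)
      then show ?thesis using f_pos by (simp add: le_divide_eq)
    qed
    ultimately have "real N \<le> s / real f" using f_pos by (meson divide_right_mono of_nat_0_le_iff order_trans)
    then show ?thesis using h by (simp add: mult_left_mono power_mono)
  qed
  ultimately show ?thesis unfolding k_def[symmetric] by linarith
qed

end

section \<open>Rare patterns\<close>

context sparse_box_scheme
begin

text \<open>With h = - ln (q (box 0)) and lam = h / (f^d * p), the side s belonging to time t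
  satisfies h * (s / f)^d = t exactly. What remains is the relative error \<eta> of h and the
  rounding to whole boxes, measured by r.\<close>

lemma scheme_bound:
  assumes A: "A \<in> patterns (cube n)"
    and m: "real (f ^ CARD('d)) * p \<le> 1 / 2"
    and \<eta>: "0 \<le> \<eta>" "\<eta> \<le> 1 / 2"
    and err: "8 * cluster_const * step_err \<le> \<eta> * (real (f ^ CARD('d)) * p)"
    and r: "0 \<le> r" "r \<le> 1" "2 * (real (f ^ CARD('d)) * p) \<le> r ^ CARD('d)"
  shows "\<exists>lam\<in>{1 / (2 * cluster_const)..2}. \<forall>t>0.
     \<bar>prob {\<sigma>. ereal_of_enat (first_occurrence n A \<sigma>) > ereal ((t / (lam * p)) powr (1 / real CARD('d)))} - exp (- t)\<bar>
     \<le> tail_const CARD('d) * (\<eta> + r) * exp (- tail_rate CARD('d) * t)"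
proof -
  define D where "D = CARD('d)"
  have D: "D > 0" by (simp add: D_def)
  define M where "M = real (f ^ D) * p"
  define q0 where "q0 = q (box 0)"
  define h where "h = - ln q0"
  define \<rho> where "\<rho> = root D h"
  let ?K = cluster_const
  have K: "?K \<ge> 1" by (rule cluster_const_ge_1)
  have M0: "M > 0" using p_pos f_pos by (simp add: M_def)
  have M1: "M \<le> 1 / 2" using m by (simp add: M_def D_def)
  have y_lo: "M / (2 * ?K) \<le> 1 - q0"
    using hitting_lower_bound[OF finite_box, of 0] M1 by (simp add: card_box M_def q0_def D_def)
  have y_hi: "1 - q0 \<le> M"
    using q_union_bound[OF finite_box, of 0] by (simp add: card_box M_def q0_def D_def)
  have q0: "1 / 2 \<le> q0" "q0 \<le> 1" using y_hi M1 q_le_1 by (auto simp: q0_def)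
  have eh: "exp (- h) = q0" using q0 by (simp add: h_def)
  have ln_lower: "- 2 * x \<le> ln (1 - x)" if "0 \<le> x" "x \<le> 1 / 2" for x :: real
  proof -
    have "x * x \<le> 1 / 2 * x" using that by (intro mult_right_mono) auto
    then have "2 * x\<^sup>2 \<le> x" by (simp add: power2_eq_square)
    then show ?thesis using ln_one_minus_pos_lower_bound[OF that] by linarith
  qed
  have h_lo: "M / (2 * ?K) \<le> h"
    using ln_le_minus_one[of q0] q0 y_lo by (simp add: h_def)
  have h_hi: "h \<le> 2 * M"
    using ln_lower[of "1 - q0"] q0 y_hi by (simp add: h_def)
  have h0: "h > 0" using h_lo M0 K by (smt (verit) divide_pos_pos)
  define lam where "lam = h / M"
  have lam: "lam \<in> {1 / (2 * ?K)..2}"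
    using h_lo h_hi M0 K by (simp add: lam_def field_simps)
  have \<rho>: "\<rho> ^ D = h" "0 < \<rho>" using D h0 by (simp_all add: \<rho>_def)
  have \<rho>r: "\<rho> \<le> r"
  proof -
    have "\<rho> ^ D \<le> r ^ D" using \<rho> h_hi r(3) by (simp add: M_def D_def)
    then show ?thesis using \<rho>(2) r(1) D by (simp add: power_mono_iff)
  qed
  \<comment> \<open>In \<open>err\<close> the factor 2 * \<open>cluster_const\<close> replaces f^d *
    p by h, and the remaining 4 covers q0 \<ge> 1 / 2 and the half on the right. That half is spent
    on ln (1 - x) \<ge> - 2 * x in \<open>lo\<close>.\<close>
  have se: "step_err \<le> q0 * (\<eta> * h / 2)"
  proof -
    have "step_err \<le> \<eta> * (M / (2 * ?K)) / 4" using err K by (simp add: M_def D_def field_simps)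
    also have "\<dots> \<le> \<eta> * h / 4" using mult_left_mono[OF h_lo \<eta>(1)] by (simp add: mult.commute)
    also have "\<dots> = 1 / 2 * (\<eta> * h / 2)" by simp
    also have "\<dots> \<le> q0 * (\<eta> * h / 2)" using q0 \<eta> h0 by (intro mult_right_mono) auto
    finally show ?thesis .
  qed
  have \<eta>h: "0 \<le> \<eta> * h" "\<eta> * h \<le> 1"
  proof -
    show "0 \<le> \<eta> * h" using \<eta> h0 by simp
    have "\<eta> * h \<le> 1 * 1" using \<eta> h0 h_hi M1 by (intro mult_mono) auto
    then show "\<eta> * h \<le> 1" by simp
  qed
  have se_le: "step_err \<le> q (box 0)"
  proof -
    have "q0 * (\<eta> * h / 2) \<le> q0 * 1" using \<eta>h q0 by (intro mult_left_mono) auto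
    then show ?thesis using se by (simp add: q0_def)
  qed
  have up: "q (box 0) + step_err \<le> exp (- (h * (1 - \<eta>)))"
  proof -
    have "q0 + step_err \<le> q0 * (1 + \<eta> * h)"
      using se \<eta>h q0 mult_nonneg_nonneg[of q0 "\<eta> * h"] by (simp add: algebra_simps)
    also have "\<dots> \<le> q0 * exp (\<eta> * h)" using q0 by (intro mult_left_mono exp_ge_add_one_self) auto
    also have "\<dots> = exp (- (h * (1 - \<eta>)))" unfolding eh[symmetric] by (simp add: exp_add[symmetric] algebra_simps)
    finally show ?thesis by (simp add: q0_def)
  qed
  have lo: "exp (- (h * (1 + \<eta>))) \<le> q (box 0) - step_err"
  proof -
    have "- (\<eta> * h) \<le> ln (1 - \<eta> * h / 2)"
      using ln_lower[of "\<eta> * h / 2"] \<eta>h by simp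
    then have "exp (- (\<eta> * h)) \<le> exp (ln (1 - \<eta> * h / 2))"
      by (simp only: exp_le_cancel_iff)
    also have "\<dots> = 1 - \<eta> * h / 2" using \<eta>h by simp
    finally have "q0 * exp (- (\<eta> * h)) \<le> q0 * (1 - \<eta> * h / 2)" using q0 by (intro mult_left_mono) auto
    also have "\<dots> \<le> q0 - step_err" using se by (simp add: algebra_simps)
    also have "q0 * exp (- (\<eta> * h)) = exp (- (h * (1 + \<eta>)))"
      unfolding eh[symmetric] by (simp add: exp_add[symmetric] algebra_simps)
    finally show ?thesis by (simp add: q0_def)
  qed
  show ?thesis
  proof (intro bexI[OF _ lam] allI impI)
    fix t :: real assume t: "0 < t"
    define s where "s = (t / (lam * p)) powr (1 / real D)"
    define v where "v = \<rho> * (s / real f)"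
    have lam0: "lam > 0" using h0 M0 by (simp add: lam_def)
    have s0: "0 \<le> s" by (simp add: s_def)
    have v0: "0 \<le> v" using s0 \<rho> by (simp add: v_def)
    have "s ^ D = t / (lam * p)"
      unfolding s_def using t lam0 p_pos D by (simp add: powr_power)
    then have vt: "v ^ D = t"
      using \<rho>(1) h0 M0 f_pos p_pos unfolding v_def
      by (simp add: power_mult_distrib power_divide lam_def M_def)
    define X where "X = q (cube (nat \<lfloor>s\<rfloor>) - {0})"
    have "X \<le> exp (- (h * (1 - \<eta>) * max 0 (s / real f - 2) ^ D))"
      unfolding X_def D_def by (rule first_passage_upper[OF s0 se_le _ up]) (use h0 \<eta> in auto)
    moreover have "h * max 0 (s / real f - 2) ^ D = max 0 (v - 2 * \<rho>) ^ D"
    proof -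
      have "h * max 0 (s / real f - 2) ^ D = (\<rho> * max 0 (s / real f - 2)) ^ D"
        using \<rho> by (simp add: power_mult_distrib)
      also have "\<rho> * max 0 (s / real f - 2) = max 0 (v - 2 * \<rho>)"
        using \<rho>(2) by (simp add: v_def max_mult_distrib_left algebra_simps)
      finally show ?thesis .
    qed
    moreover have "h * (1 - \<eta>) * max 0 (s / real f - 2) ^ D = (1 - \<eta>) * (h * max 0 (s / real f - 2) ^ D)"
      by (simp only: mult_ac)
    ultimately have U: "X \<le> exp (- ((1 - \<eta>) * max 0 (v - 2 * \<rho>) ^ D))" by (simp only:)
    have "exp (- (h * (1 + \<eta>) * (s / real f + 1) ^ D)) \<le> X"
      unfolding X_def D_def by (rule first_passage_lower[OF s0 se_le _ lo]) (use h0 \<eta> in auto)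
    moreover have "h * (s / real f + 1) ^ D = (v + \<rho>) ^ D"
    proof -
      have "h * (s / real f + 1) ^ D = (\<rho> * (s / real f + 1)) ^ D"
        using \<rho> by (simp add: power_mult_distrib)
      then show ?thesis by (simp add: v_def algebra_simps)
    qed
    moreover have "h * (1 + \<eta>) * (s / real f + 1) ^ D = (1 + \<eta>) * (h * (s / real f + 1) ^ D)"
      by (simp only: mult_ac)
    ultimately have Lo: "exp (- ((1 + \<eta>) * (v + \<rho>) ^ D)) \<le> X" by (simp only:)
    have "\<bar>X - exp (- t)\<bar> \<le> tail_const D * (\<eta> + \<rho>) * exp (- tail_rate D * t)"
      using exp_approximation[OF v0 _ _ \<eta> Lo U] \<rho>(2) \<rho>r r(2) by (simp add: vt)
    also have "\<dots> \<le> tail_const D * (\<eta> + r) * exp (- tail_rate D * t)"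
      using \<rho>r by (intro mult_right_mono mult_left_mono) (auto simp: tail_const_def)
    finally show "\<bar>prob {\<sigma>. ereal_of_enat (first_occurrence n A \<sigma>) > ereal ((t / (lam * p)) powr (1 / real CARD('d)))} - exp (- t)\<bar>
      \<le> tail_const CARD('d) * (\<eta> + r) * exp (- tail_rate CARD('d) * t)"
      using prob_first_occurrence[OF A s0] by (simp add: X_def s_def D_def)
  qed
qed

end

context mixing_field
begin

text \<open>For a gap width l from L0 on, the conditions yield in order: r = 32 / l at most 1,
  sparsity of the boxes, a relative error of at most 1 / 2, n \<le> l / 2, and a mixing error of at
  most l^-(2 d + 1).\<close>

definition scale_threshold :: "real \<Rightarrow> bool" where
  "scale_threshold L0 \<longleftrightarrow> L0 \<ge> 32 \<and> L0 \<ge> 2 * 2 ^ (3 ^ CARD('d)) * (16 ^ CARD('d) + 1) \<and>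
     L0 \<ge> 16 * cluster_const * (2 ^ (3 ^ CARD('d)) + 1) * (2 * real CARD('d) * 16 ^ CARD('d) + 1) \<and>
     (\<forall>x\<ge>L0. 4 * real CARD('d) * ln x \<le> ln (1 / \<gamma>) * (x / 2)) \<and>
     (\<forall>x\<ge>L0. 2 ^ CARD('d) * C1 * x ^ (4 * CARD('d) + 1) * exp (- C2 * (x / 2)) \<le> 1)"

lemma scale_threshold_exists: "\<exists>L0. scale_threshold L0"
proof -
  let ?D = "CARD('d)"
  define \<epsilon> where "\<epsilon> = ln (1 / \<gamma>) / (8 * real ?D)"
  have \<epsilon>: "\<epsilon> > 0" using \<gamma>_pos \<gamma>_less_1 by (simp add: \<epsilon>_def)
  have "eventually (\<lambda>x. ln x / x < \<epsilon>) at_top"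
    using order_tendstoD(2)[OF ln_x_over_x_tendsto_0 \<epsilon>] .
  then obtain N where N: "\<And>x. x \<ge> N \<Longrightarrow> ln x / x < \<epsilon>" by (auto simp: eventually_at_top_linorder)
  define k where "k = 4 * ?D + 1"
  define c where "c = C2 / 2"
  \<comment> \<open>The power k + 1 instead of k yields a spare factor 1 / x, which brings the
    product below 1 once x exceeds \<open>B\<close>.\<close>
  define B where "B = 2 ^ ?D * C1 * (fact (k + 1) / c ^ (k + 1))"
  have c: "c > 0" using C2_pos by (simp add: c_def)
  define L0 where "L0 = Max {32, 2 * 2 ^ (3 ^ ?D) * (16 ^ ?D + 1),
     16 * cluster_const * (2 ^ (3 ^ ?D) + 1) * (2 * real ?D * 16 ^ ?D + 1), N, B}"
  have L0: "32 \<le> L0" "2 * 2 ^ (3 ^ ?D) * (16 ^ ?D + 1) \<le> L0"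
    "16 * cluster_const * (2 ^ (3 ^ ?D) + 1) * (2 * real ?D * 16 ^ ?D + 1) \<le> L0" "N \<le> L0" "B \<le> L0"
    unfolding L0_def by (rule Max_ge; simp)+
  have "4 * real ?D * ln x \<le> ln (1 / \<gamma>) * (x / 2)" if "x \<ge> L0" for x
  proof -
    have x: "x > 0" "N \<le> x" using that L0 by auto
    have "ln x \<le> \<epsilon> * x" using N[OF x(2)] x(1) by (simp add: divide_less_eq)
    then have "4 * real ?D * ln x \<le> 4 * real ?D * (\<epsilon> * x)" by (intro mult_left_mono) auto
    also have "\<dots> = ln (1 / \<gamma>) * (x / 2)" by (simp add: \<epsilon>_def)
    finally show ?thesis .
  qed
  moreover have "2 ^ ?D * C1 * x ^ k * exp (- C2 * (x / 2)) \<le> 1" if "x \<ge> L0" for x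
  proof -
    have x: "x > 0" "B \<le> x" using that L0 by auto
    have "(c * x) ^ (k + 1) \<le> fact (k + 1) * exp (c * x)"
      by (rule power_le_fact_exp) (use c x in auto)
    then have "x * (x ^ k * exp (- (c * x))) \<le> fact (k + 1) / c ^ (k + 1)"
      using c by (simp add: power_mult_distrib exp_minus field_simps)
    then have "2 ^ ?D * C1 * (x * (x ^ k * exp (- (c * x)))) \<le> B"
      unfolding B_def using C1_pos by (intro mult_left_mono) auto
    also have "\<dots> \<le> x" by (rule x(2))
    finally have "x * (2 ^ ?D * C1 * x ^ k * exp (- (c * x))) \<le> x * 1" by (simp add: mult_ac)
    then have "2 ^ ?D * C1 * x ^ k * exp (- (c * x)) \<le> 1" using x(1) by simp
    then show ?thesis by (simp add: c_def)
  qed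
  ultimately show ?thesis using L0 unfolding scale_threshold_def k_def by blast
qed

lemma rare_pattern_bound:
  "\<exists>C>0. \<exists>p0>0. \<forall>n. \<forall>A\<in>patterns (cube n). measure P (cylinder (cube n) A) \<le> p0 \<longrightarrow>
     (\<exists>lam\<in>{1 / (2 * cluster_const)..2}. \<forall>t>0.
       \<bar>measure P {\<sigma>. ereal_of_enat (first_occurrence n A \<sigma>) >
          ereal ((t / (lam * measure P (cylinder (cube n) A))) powr (1 / real CARD('d)))} - exp (- t)\<bar>
       \<le> C * measure P (cylinder (cube n) A) powr (1 / (4 * real CARD('d))) * exp (- tail_rate CARD('d) * t))"
proof -
  define D where "D = CARD('d)"
  have D: "D > 0" by (simp add: D_def)
  define K where "K = (2 :: real) ^ (3 ^ D)"
  \<comment> \<open>Chosen so that 8 * \<open>cluster_const\<close> * \<open>step_err\<close> is at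
    most a / l times the mean number of occurrences in a box.\<close>
  define a where "a = 8 * cluster_const * (K + 1) * (2 * real D * 16 ^ D + 1)"
  have K: "K \<ge> 1" by (simp add: K_def)
  have Kc: "cluster_const \<ge> 1" by (rule cluster_const_ge_1)
  have a: "a > 0" using K Kc by (simp add: a_def add_nonneg_pos)
  obtain L0 where "scale_threshold L0" using scale_threshold_exists by blast
  then have L0: "L0 \<ge> 32" "L0 \<ge> 2 * K * (16 ^ D + 1)" "L0 \<ge> 2 * a"
    and L0_ln: "\<And>x. x \<ge> L0 \<Longrightarrow> 4 * real D * ln x \<le> ln (1 / \<gamma>) * (x / 2)"
    and L0_exp: "\<And>x. x \<ge> L0 \<Longrightarrow> 2 ^ D * C1 * x ^ (4 * D + 1) * exp (- C2 * (x / 2)) \<le> 1"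
    unfolding scale_threshold_def D_def K_def a_def by auto
  define p0 where "p0 = 1 / L0 ^ (4 * D)"
  have p0: "p0 > 0" using L0 by (simp add: p0_def)
  let ?C = "tail_const D * (a + 32)"
  have tc: "tail_const D > 0" by (simp add: tail_const_def add_pos_nonneg)
  have C: "?C > 0" using a tc by simp
  show ?thesis
  proof (rule exI[of _ ?C], rule conjI[OF C], rule exI[of _ p0], rule conjI[OF p0], intro allI ballI impI)
    fix n and A :: "('d, 'a) config"
    assume A: "A \<in> patterns (cube n)" and pp: "measure P (cylinder (cube n) A) \<le> p0"
    interpret pattern_field P C1 C2 \<gamma> n A by unfold_locales
    have pc: "measure P (cylinder (cube n) A) = p" by (rule p_eq_cylinder[OF A])
    have p1: "p \<le> 1" by (simp add: p_def)
    \<comment> \<open>The ideal real gap, with x^(4 d) * p = 1. Rounding up to L at most doubles it,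
      whence 16^d = 2^(4 d) in \<open>lp_hi\<close>.\<close>
    define x where "x = p powr (- (1 / (4 * real D)))"
    have x0: "x > 0" using p_pos by (simp add: x_def)
    have xp: "x ^ (4 * D) = 1 / p"
    proof -
      have "x ^ (4 * D) = p powr (- (1 / (4 * real D)) * real (4 * D))"
        unfolding x_def using p_pos by (simp add: powr_power)
      also have "- (1 / (4 * real D)) * real (4 * D) = - 1" using D by simp
      finally show ?thesis using p_pos by (simp add: powr_minus_divide)
    qed
    have xL0: "L0 \<le> x"
    proof -
      have "L0 ^ (4 * D) \<le> x ^ (4 * D)"
        using pp p_pos L0 unfolding xp pc p0_def by (simp add: field_simps)
      then show ?thesis using D L0 x0 by (simp add: power_mono_iff)
    qed
    define L where "L = nat \<lceil>x\<rceil>"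
    have Lx: "x \<le> real L" "real L \<le> x + 1"
      using x0 by (auto simp: L_def)
    define l where "l = real L"
    have lL0: "l \<ge> L0" using Lx xL0 by (simp add: l_def)
    have l: "l \<ge> 32" "l > 0" using lL0 L0 by auto
    have l2x: "l \<le> 2 * x" using Lx xL0 L0 by (simp add: l_def)
    have lp_lo: "1 \<le> l ^ (4 * D) * p"
    proof -
      have "x ^ (4 * D) * p \<le> l ^ (4 * D) * p"
        using Lx x0 p_pos by (intro mult_right_mono power_mono) (auto simp: l_def)
      then show ?thesis using p_pos by (simp add: xp)
    qed
    have lp_hi: "l ^ (4 * D) * p \<le> 16 ^ D"
    proof -
      have "l ^ (4 * D) * p \<le> (2 * x) ^ (4 * D) * p"
        using l l2x p_pos by (intro mult_right_mono power_mono) auto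
      also have "\<dots> = 2 ^ (4 * D)"
        unfolding power_mult_distrib xp using p_pos by simp
      also have "\<dots> = 16 ^ D" by (simp add: power_mult)
      finally show ?thesis .
    qed
    have n_le: "real n \<le> l / 2"
    proof -
      have g: "ln (1 / \<gamma>) > 0" using \<gamma>_pos \<gamma>_less_1 by simp
      have "ln p \<le> ln (\<gamma> ^ (n + 1))" using p_le p_pos \<gamma>_pos by (subst ln_le_cancel_iff) auto
      then have "real (n + 1) * ln (1 / \<gamma>) \<le> - ln p"
        using \<gamma>_pos by (simp add: ln_realpow ln_div algebra_simps del: power_Suc)
      also have "- ln p = ln (x ^ (4 * D))" using p_pos by (simp add: xp ln_div)
      also have "\<dots> = 4 * real D * ln x" using x0 by (simp add: ln_realpow)
      also have "\<dots> \<le> 4 * real D * ln l" using x0 Lx l by (intro mult_left_mono) (auto simp: l_def)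
      also have "\<dots> \<le> ln (1 / \<gamma>) * (l / 2)" by (rule L0_ln[OF lL0])
      finally have "ln (1 / \<gamma>) * real (n + 1) \<le> ln (1 / \<gamma>) * (l / 2)" by (simp add: mult.commute)
      then show ?thesis using g by (simp add: mult_le_cancel_left_pos)
    qed
    have nL: "n < L" using n_le l by (simp add: l_def)
    have Lf: "2 * L \<le> L\<^sup>2"
      using l by (simp add: l_def power2_eq_square)
    interpret box_scheme P C1 C2 \<gamma> n A "L\<^sup>2" L by unfold_locales (use nL Lf in auto)
    have ff: "real (L\<^sup>2) = l ^ 2" by (simp add: l_def)
    define M where "M = real ((L\<^sup>2) ^ D) * p"
    have Ml: "M = l ^ (2 * D) * p" by (simp add: M_def l_def power_mult)
    have l_split: "l ^ (4 * D) = l ^ (2 * D) * l ^ (2 * D)" by (simp add: power_add[symmetric])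
    have l2D: "l ^ (2 * D) > 0" using l by simp
    have l_le: "l \<le> l ^ (2 * D)" using l D by (intro self_le_power) auto
    have M_lo: "1 / l ^ (2 * D) \<le> M"
      using lp_lo[unfolded l_split] l2D by (simp add: Ml divide_le_eq mult_ac)
    have M_hi: "M \<le> 16 ^ D / l ^ (2 * D)"
      using lp_hi[unfolded l_split] l2D by (simp add: Ml le_divide_eq mult_ac)
    have mixe: "mix_err \<le> 1 / l ^ (2 * D + 1)"
    proof -
      have "mix_err = (l ^ 2 + real n) ^ D * (C1 * exp (- C2 * (l - real n)))"
        by (simp add: mix_err_def D_def l_def)
      also have "\<dots> \<le> (2 * l ^ 2) ^ D * (C1 * exp (- C2 * (l / 2)))"
      proof (intro mult_mono power_mono mult_left_mono)
        show "l\<^sup>2 + real n \<le> 2 * l\<^sup>2"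
          using n_le l by (simp add: power2_eq_square) (smt (verit) mult_left_le_one_le mult_le_cancel_left1)
        show "exp (- C2 * (l - real n)) \<le> exp (- C2 * (l / 2))"
          using n_le C2_pos by (simp add: mult_left_mono)
      qed (use C1_pos l in auto)
      also have "\<dots> = (2 ^ D * C1 * l ^ (4 * D + 1) * exp (- C2 * (l / 2))) / l ^ (2 * D + 1)"
      proof -
        have "(2 * l ^ 2) ^ D = 2 ^ D * l ^ (2 * D)" by (simp add: power_mult_distrib power_mult)
        moreover have "l ^ (4 * D + 1) = l ^ (2 * D) * l ^ (2 * D + 1)" by (simp add: power_add[symmetric])
        moreover have "l ^ (2 * D + 1) \<noteq> 0" using l by simp
        ultimately show ?thesis by (simp only:) (simp del: power_Suc add: mult_ac)
      qed
      also have "\<dots> \<le> 1 / l ^ (2 * D + 1)"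
        using L0_exp[OF lL0] l by (intro divide_right_mono) auto
      finally show ?thesis .
    qed
    \<comment> \<open>A surface term: smaller by the order L / f = 1 / l than the mass of the box,
      which is about l^(-2 d).\<close>
    have rim: "rim_mass \<le> 2 * real D * 16 ^ D / l ^ (2 * D + 1)"
    proof -
      have "real (L\<^sup>2) ^ D - real (L\<^sup>2 - 2 * L) ^ D \<le> real D * (real (L\<^sup>2) - real (L\<^sup>2 - 2 * L)) * real (L\<^sup>2) ^ (D - 1)"
        by (rule power_diff_le) auto
      also have "real (L\<^sup>2) - real (L\<^sup>2 - 2 * L) = 2 * l"
        using Lf by (simp add: of_nat_diff l_def)
      also have "real (L\<^sup>2) ^ (D - 1) = l ^ (2 * (D - 1))" by (simp only: ff power_mult)
      finally have "rim_mass \<le> real D * (2 * l) * l ^ (2 * (D - 1)) * p"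
        unfolding rim_mass_def D_def using p_pos by (intro mult_right_mono) auto
      also have "\<dots> = 2 * real D * (l ^ (4 * D) * p) / l ^ (2 * D + 1)"
      proof -
        have "l * l ^ (2 * (D - 1)) * l ^ (2 * D + 1) = l ^ (4 * D)"
        proof -
          have e: "4 * D = 1 + 2 * (D - 1) + (2 * D + 1)" using D by simp
          show ?thesis unfolding e by (simp only: power_add power_one_right)
        qed
        then show ?thesis using l by (simp add: field_simps)
      qed
      also have "\<dots> \<le> 2 * real D * 16 ^ D / l ^ (2 * D + 1)"
        using lp_hi l by (intro divide_right_mono mult_left_mono) auto
      finally show ?thesis .
    qed
    have nf: "near_factor = K" by (simp add: near_factor_def K_def D_def)
    interpret sparse_box_scheme P C1 C2 \<gamma> n A "L\<^sup>2" L
    proof unfold_locales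
      have "mix_err \<le> 1 / l"
      proof -
        have "l \<le> l ^ (2 * D + 1)" using l by (intro self_le_power) auto
        then have "1 / l ^ (2 * D + 1) \<le> 1 / l" using l by (intro divide_left_mono) auto
        then show ?thesis using mixe by linarith
      qed
      moreover have "M \<le> 16 ^ D / l"
        using M_hi l_le l divide_left_mono[of l "l ^ (2 * D)" "16 ^ D"] by simp
      ultimately have "M + mix_err \<le> (16 ^ D + 1) / l" by (simp add: add_divide_distrib)
      then have "K * (M + mix_err) \<le> K * ((16 ^ D + 1) / l)" using K by (intro mult_left_mono) auto
      also have "\<dots> \<le> 1 / 2" using L0(2) lL0 l by (simp add: field_simps)
      finally show "near_factor * (real ((L\<^sup>2) ^ CARD('d)) * p + mix_err) \<le> 1 / 2"
        by (simp add: nf M_def D_def)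
    qed
    have se: "step_err \<le> (K + 1) * (2 * real D * 16 ^ D + 1) / l ^ (2 * D + 1)"
    proof -
      have "rim_mass + mix_err \<le> (2 * real D * 16 ^ D + 1) / l ^ (2 * D + 1)"
        using rim mixe by (simp add: add_divide_distrib)
      then have "(K + 1) * (rim_mass + mix_err) \<le> (K + 1) * ((2 * real D * 16 ^ D + 1) / l ^ (2 * D + 1))"
        using K by (intro mult_left_mono) auto
      then show ?thesis by (simp add: step_err_def nf)
    qed
    have "\<exists>lam\<in>{1 / (2 * cluster_const)..2}. \<forall>t>0.
     \<bar>prob {\<sigma>. ereal_of_enat (first_occurrence n A \<sigma>) > ereal ((t / (lam * p)) powr (1 / real CARD('d)))} - exp (- t)\<bar>
     \<le> tail_const CARD('d) * (a / l + 32 / l) * exp (- tail_rate CARD('d) * t)"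
    proof (rule scheme_bound[OF A])
      have "M \<le> 16 ^ D / l"
        using M_hi l_le l divide_left_mono[of l "l ^ (2 * D)" "16 ^ D"] by simp
      also have "\<dots> \<le> 1 / 2"
      proof -
        have "2 * 1 * (16 ^ D + 1) \<le> 2 * K * (16 ^ D + 1)" using K by (intro mult_right_mono) auto
        then have "2 * 16 ^ D \<le> l" using L0(2) lL0 by simp
        then show ?thesis using l by (simp add: field_simps)
      qed
      finally show "real ((L\<^sup>2) ^ CARD('d)) * p \<le> 1 / 2" by (simp add: M_def D_def)
      show "0 \<le> a / l" using a l by simp
      show "a / l \<le> 1 / 2" using L0(3) lL0 l by (simp add: field_simps)
      have "8 * cluster_const * step_err
          \<le> 8 * cluster_const * ((K + 1) * (2 * real D * 16 ^ D + 1) / l ^ (2 * D + 1))"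
        using se Kc by (intro mult_left_mono) auto
      also have "\<dots> = a / l * (1 / l ^ (2 * D))" by (simp add: a_def)
      also have "\<dots> \<le> a / l * M" using M_lo a l by (intro mult_left_mono) auto
      finally show "8 * cluster_const * step_err \<le> a / l * (real ((L\<^sup>2) ^ CARD('d)) * p)"
        by (simp add: M_def D_def)
      \<comment> \<open>A generous r, of the same order 1 / l as \<eta>; the number is 2 * 16, from
        2 * 16^d \<le> 32^d.\<close>
      show "0 \<le> 32 / l" "32 / l \<le> 1" using l by auto
      have "2 * M \<le> 2 * (16 ^ D / l ^ (2 * D))" using M_hi by simp
      also have "\<dots> \<le> 2 ^ D * (16 ^ D / l ^ (2 * D))"
        using l D self_le_power[of "2 :: real" D] by (intro mult_right_mono) auto
      also have "\<dots> \<le> 2 ^ D * (16 ^ D / l ^ D)"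
        using l by (intro mult_left_mono divide_left_mono power_increasing) auto
      also have "\<dots> = (32 / l) ^ D" by (simp add: power_divide power_mult_distrib[symmetric])
      finally show "2 * (real ((L\<^sup>2) ^ CARD('d)) * p) \<le> (32 / l) ^ CARD('d)"
        by (simp add: M_def D_def)
    qed
    moreover have "tail_const D * (a / l + 32 / l) * exp (- tail_rate D * t)
        \<le> ?C * p powr (1 / (4 * real D)) * exp (- tail_rate D * t)" for t
    proof -
      have "a / l + 32 / l = (a + 32) * (1 / l)" by (simp add: add_divide_distrib)
      also have "\<dots> \<le> (a + 32) * (1 / x)"
        using Lx x0 a by (intro mult_left_mono divide_left_mono) (auto simp: l_def)
      also have "1 / x = p powr (1 / (4 * real D))" by (simp add: x_def powr_minus_divide)
      finally have "tail_const D * (a / l + 32 / l) \<le> tail_const D * ((a + 32) * p powr (1 / (4 * real D)))"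
        using tc by (intro mult_left_mono) auto
      then show ?thesis by (intro mult_right_mono) (auto simp: mult.assoc)
    qed
    ultimately show "\<exists>lam\<in>{1 / (2 * cluster_const)..2}. \<forall>t>0.
       \<bar>measure P {\<sigma>. ereal_of_enat (first_occurrence n A \<sigma>) >
          ereal ((t / (lam * measure P (cylinder (cube n) A))) powr (1 / real CARD('d)))} - exp (- t)\<bar>
       \<le> ?C * measure P (cylinder (cube n) A) powr (1 / (4 * real CARD('d))) * exp (- tail_rate CARD('d) * t)"
      unfolding pc D_def by (meson order_trans)
  qed
qed

end

section \<open>Frequent patterns\<close>

context mixing_field
begin

lemma frequent_pattern_bound:
  assumes p0: "p0 > 0"
  shows "\<exists>C>0. \<exists>c>0. \<forall>n. \<forall>A\<in>patterns (cube n). p0 \<le> measure P (cylinder (cube n) A) \<longrightarrow>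
     (\<forall>t>0. \<bar>measure P {\<sigma>. ereal_of_enat (first_occurrence n A \<sigma>) >
          ereal ((t / (1 * measure P (cylinder (cube n) A))) powr (1 / real CARD('d)))} - exp (- t)\<bar>
       \<le> C * exp (- c * t))"
proof -
  define D where "D = CARD('d)"
  have D: "D > 0" by (simp add: D_def)
  obtain n0 where n0: "\<gamma> ^ n0 < p0"
    using real_arch_pow_inv[OF p0 \<gamma>_less_1] by blast
  define B where "B = real ((n0 + 1) ^ D) * C1"
  have B: "B > 0" using C1_pos by (simp add: B_def)
  \<comment> \<open>The solution of B * exp (- C2 * y) = p0 / 2 if that is nonnegative.\<close>
  define y where "y = max 0 (- ln (p0 / 2 / B) / C2)"
  define M where "M = n0 + 1 + nat \<lceil>y\<rceil>"
  have MB: "B * exp (- C2 * (real M - real n0)) \<le> p0 / 2"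
  proof -
    have "y \<le> real M - real n0" by (simp add: M_def) linarith
    then have "- ln (p0 / 2 / B) / C2 \<le> real M - real n0" by (simp add: y_def)
    then have "- C2 * (real M - real n0) \<le> ln (p0 / 2 / B)"
      unfolding pos_divide_le_eq[OF C2_pos] by (simp add: mult.commute)
    then have "exp (- C2 * (real M - real n0)) \<le> p0 / 2 / B"
      using p0 B by (metis divide_pos_pos exp_le_cancel_iff exp_ln zero_less_numeral)
    then show ?thesis using B by (simp add: field_simps)
  qed
  define \<kappa> where "\<kappa> = p0 / 2"
  \<comment> \<open>About (s / M)^d grid points contribute \<kappa> each; the 2 comes from
    \<open>shifted_power_ge\<close>, and the cap 1 lets exp (- t) be dominated as well.\<close>
  define c where "c = min 1 (\<kappa> / (2 * real M) ^ D)"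
  define C where "C = exp (\<kappa> * 2 ^ D) + 1"
  have M0: "real M \<ge> 1" by (simp add: M_def)
  have \<kappa>: "\<kappa> > 0" using p0 by (simp add: \<kappa>_def)
  have c: "c > 0" using \<kappa> M0 by (simp add: c_def)
  have C: "C > 0" by (simp add: C_def add_pos_pos)
  show ?thesis
  proof (rule exI[of _ C], rule conjI[OF C], rule exI[of _ c], rule conjI[OF c], intro allI ballI impI)
    fix n and A :: "('d, 'a) config" and t :: real
    assume A: "A \<in> patterns (cube n)" and pp: "p0 \<le> measure P (cylinder (cube n) A)" and t: "0 < t"
    interpret pattern_field P C1 C2 \<gamma> n A by unfold_locales
    have pc: "measure P (cylinder (cube n) A) = p" by (rule p_eq_cylinder[OF A])
    have pp0: "p0 \<le> p" using pp by (simp add: pc)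
    have p1: "p \<le> 1" by (simp add: p_def)
    have nn0: "n < n0"
    proof (rule ccontr)
      assume "\<not> n < n0"
      then have "\<gamma> ^ (n + 1) \<le> \<gamma> ^ n0" using \<gamma>_pos \<gamma>_less_1 by (intro power_decreasing) auto
      then show False using p_le pp0 n0 by linarith
    qed
    have nM: "n < M" using nn0 by (simp add: M_def)
    have err: "real ((n + 1) ^ CARD('d)) * (C1 * exp (- C2 * (real M - real n))) \<le> p / 2"
    proof -
      have "real ((n + 1) ^ D) * (C1 * exp (- C2 * (real M - real n)))
          \<le> real ((n0 + 1) ^ D) * (C1 * exp (- C2 * (real M - real n0)))"
        using nn0 C1_pos C2_pos
        by (intro mult_mono of_nat_mono power_mono) (auto intro!: mult_left_mono)
      also have "\<dots> = B * exp (- C2 * (real M - real n0))" by (simp add: B_def)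
      finally show ?thesis using MB pp0 by (simp add: D_def)
    qed
    define s where "s = (t / p) powr (1 / real D)"
    define k where "k = nat \<lfloor>s\<rfloor>"
    have s0: "0 \<le> s" by (simp add: s_def)
    have sD: "s ^ D = t / p" unfolding s_def using t p_pos D by (simp add: powr_power)
    define N where "N = k div M"
    define I :: "'d site set" where "I = {b. \<forall>i. b $ i \<in> {1..int N}}"
    have fI: "finite I" unfolding I_def by (rule finite_vec_box) simp
    have cI: "card I = N ^ D" unfolding I_def card_vec_box by (simp add: D_def)
    have sub: "(\<lambda>b. \<chi> i. int M * b $ i) ` I \<subseteq> cube k - {0}"
    proof (rule image_subsetI)
      fix b assume "b \<in> I"
      then have bi: "1 \<le> b $ i" "b $ i \<le> int N" for i by (auto simp: I_def)
      have "0 < int M * b $ i \<and> int M * b $ i \<le> int k" for i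
      proof
        show "0 < int M * b $ i" using bi[of i] M0 by simp
        have "int M * b $ i \<le> int M * int N" using bi[of i] by (intro mult_left_mono) auto
        also have "\<dots> \<le> int k" unfolding N_def of_nat_mult[symmetric] of_nat_le_iff by simp
        finally show "int M * b $ i \<le> int k" .
      qed
      then have pos: "0 < (\<chi> i. int M * b $ i) $ i \<and> (\<chi> i. int M * b $ i) $ i \<le> int k" for i
        by (simp only: vec_lambda_beta)
      then have "(\<chi> i. int M * b $ i) \<noteq> 0" by (metis less_irrefl zero_index)
      moreover have "(\<chi> i. int M * b $ i) \<in> cube k"
        unfolding cube_def using pos less_imp_le by blast
      ultimately show "(\<chi> i. int M * b $ i) \<in> cube k - {0}" by blast
    qed
    have "q (cube k - {0}) \<le> q ((\<lambda>b. \<chi> i. int M * b $ i) ` I)"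
      by (rule q_antimono[OF _ sub]) (simp add: finite_cube)
    also have "\<dots> \<le> (1 - p / 2) ^ card I" by (rule q_spread_points[OF nM err fI])
    also have "\<dots> \<le> exp (- \<kappa>) ^ card I"
    proof (rule power_mono)
      have "1 - p / 2 \<le> 1 + - \<kappa>" using pp0 by (simp add: \<kappa>_def)
      also have "\<dots> \<le> exp (- \<kappa>)" by (rule exp_ge_add_one_self)
      finally show "1 - p / 2 \<le> exp (- \<kappa>)" .
      show "0 \<le> 1 - p / 2" using p1 by simp
    qed
    also have "\<dots> = exp (- (\<kappa> * real N ^ D))"
      by (simp add: cI exp_of_nat_mult[symmetric] mult.commute)
    also have "\<dots> \<le> exp (\<kappa> * 2 ^ D) * exp (- c * t)"
    proof -
      have ks: "s \<le> real (k + 1)" using s0 real_of_int_floor_add_one_ge[of s] by (simp add: k_def add.commute)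
      have "k < (N + 1) * M" unfolding N_def using M0 by (simp add: dividend_less_div_times)
      then have "k + 1 \<le> (N + 1) * M" by simp
      then have "real (k + 1) \<le> (real N + 1) * real M"
        by (metis of_nat_1 of_nat_add of_nat_le_iff of_nat_mult)
      then have "s / real M \<le> real N + 1" using ks M0 by (simp add: divide_le_eq)
      then have "(s / real M / 2) ^ D - 2 ^ D \<le> real N ^ D"
        by (intro shifted_power_ge) (use s0 in auto)
      then have "\<kappa> * ((s / real M / 2) ^ D - 2 ^ D) \<le> \<kappa> * real N ^ D" using \<kappa> by (intro mult_left_mono) auto
      moreover have "c * t \<le> \<kappa> * (s / real M / 2) ^ D"
      proof -
        have "t \<le> t / p" using t p_pos p1 by (simp add: le_divide_eq mult_left_le)
        then have "c * t \<le> \<kappa> / (2 * real M) ^ D * (t / p)"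
          using t \<kappa> c by (intro mult_mono) (auto simp: c_def)
        also have "\<dots> = \<kappa> * (s / real M / 2) ^ D"
          by (simp add: power_divide power_mult_distrib sD mult.commute)
        finally show ?thesis .
      qed
      ultimately have "- (\<kappa> * real N ^ D) \<le> \<kappa> * 2 ^ D + - c * t" by (simp add: algebra_simps)
      then show ?thesis by (simp add: exp_add[symmetric])
    qed
    finally have X: "q (cube k - {0}) \<le> exp (\<kappa> * 2 ^ D) * exp (- c * t)" .
    have "c * t \<le> 1 * t" using t by (intro mult_right_mono) (auto simp: c_def)
    then have "exp (- t) \<le> exp (- c * t)" by simp
    with X have "\<bar>q (cube k - {0}) - exp (- t)\<bar> \<le> C * exp (- c * t)"
      using q_nonneg[of "cube k - {0}"] exp_ge_zero[of "- t"]
        mult_nonneg_nonneg[OF exp_ge_zero[of "\<kappa> * 2 ^ D"] exp_ge_zero[of "- c * t"]]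
      unfolding C_def distrib_right by (simp only: abs_le_iff) linarith
    then show "\<bar>measure P {\<sigma>. ereal_of_enat (first_occurrence n A \<sigma>) >
          ereal ((t / (1 * measure P (cylinder (cube n) A))) powr (1 / real CARD('d)))} - exp (- t)\<bar>
       \<le> C * exp (- c * t)"
      using prob_first_occurrence[OF A s0] by (simp add: pc k_def s_def D_def)
  qed
qed

end

text \<open>Every site carries the pattern, but the origin does not count. This alphabet stands
  apart because p = 1 rules out finite energy with \<gamma> < 1.\<close>

lemma first_occurrence_singleton_alphabet:
  fixes A :: "('d::finite, 'a::finite) config"
  assumes card: "CARD('a) = 1" and A: "A \<in> patterns (cube n)"
  shows "first_occurrence n A \<sigma> = 1"
proof -
  obtain a where "(UNIV :: 'a set) = {a}" using card by (auto simp: card_1_singleton_iff)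
  then have single: "u = v" for u v :: 'a by (metis UNIV_I singletonD)
  have eq: "restrict (translate x \<sigma>) (cube n) = A" for x
  proof
    fix y show "restrict (translate x \<sigma>) (cube n) y = A y"
      by (rule single)
  qed
  have "occurs_within n A \<sigma> 1"
    unfolding occurs_within_def eq
    by (intro exI[of _ "1"]) (auto simp: l1_pos_iff)
  moreover have "\<not> occurs_within n A \<sigma> 0"
  proof
    assume "occurs_within n A \<sigma> 0"
    then obtain x :: "'d site" where "\<And>i. 0 \<le> x $ i" "\<And>i. x $ i \<le> 0" "x \<noteq> 0"
      unfolding occurs_within_def l1_pos_iff by auto
    then show False by (metis order_antisym vec_eq_iff zero_index)
  qed
  ultimately have "(LEAST k. occurs_within n A \<sigma> k) = 1"
    by (intro Least_equality) (auto simp: Suc_le_eq intro: gr0I)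
  then show ?thesis
    using \<open>occurs_within n A \<sigma> 1\<close> by (auto simp: first_occurrence_def one_enat_def)
qed

section \<open>The exponential law\<close>

lemma (in mixing_field) exponential_law:
  "\<exists>C>0. \<exists>c>0. \<exists>\<rho>>0. \<exists>\<Lambda>1>0. \<exists>\<Lambda>2>0. \<Lambda>1 \<le> \<Lambda>2 \<and>
    (\<forall>n. \<forall>A\<in>patterns (cube n). \<exists>lam\<in>{\<Lambda>1..\<Lambda>2}. \<forall>t>0.
       \<bar>measure P {\<sigma>. ereal_of_enat (first_occurrence n A \<sigma>) >
            ereal ((t / (lam * measure P (cylinder (cube n) A))) powr (1 / real CARD('d)))}
          - exp (- t)\<bar>
       \<le> C * measure P (cylinder (cube n) A) powr \<rho> * exp (- c * t))"
proof -
  define \<rho> where "\<rho> = 1 / (4 * real CARD('d))"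
  define \<theta> where "\<theta> = tail_rate CARD('d)"
  define dev where "dev = (\<lambda>n (A :: ('d, 'a) config) lam t.
      \<bar>measure P {\<sigma>. ereal_of_enat (first_occurrence n A \<sigma>) >
            ereal ((t / (lam * measure P (cylinder (cube n) A))) powr (1 / real CARD('d)))} - exp (- t)\<bar>)"
  obtain Cr p0 where Cr: "Cr > 0" "p0 > 0" and rare: "\<And>n A. A \<in> patterns (cube n) \<Longrightarrow>
      measure P (cylinder (cube n) A) \<le> p0 \<Longrightarrow>
      \<exists>lam\<in>{1 / (2 * cluster_const)..2}. \<forall>t>0.
        dev n A lam t \<le> Cr * measure P (cylinder (cube n) A) powr \<rho> * exp (- \<theta> * t)"
    using rare_pattern_bound unfolding dev_def \<rho>_def \<theta>_def by blast
  obtain Cf c where Cf: "Cf > 0" "c > 0" and frequent: "\<And>n A t. A \<in> patterns (cube n) \<Longrightarrow>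
      p0 \<le> measure P (cylinder (cube n) A) \<Longrightarrow> t > 0 \<Longrightarrow> dev n A 1 t \<le> Cf * exp (- c * t)"
    using frequent_pattern_bound[OF Cr(2)] unfolding dev_def by blast
  \<comment> \<open>Above p0 the power of p is at least p0 powr \<rho>, so the second entry supplies
    the factor that the frequent case lacks.\<close>
  define C where "C = max Cr (Cf / p0 powr \<rho>)"
  define b where "b = min c \<theta>"
  have \<theta>: "\<theta> > 0" by (simp add: \<theta>_def tail_rate_def)
  have C: "C > 0" using Cr by (simp add: C_def)
  have b: "b > 0" using Cf \<theta> by (simp add: b_def)
  have \<rho>: "\<rho> > 0" by (simp add: \<rho>_def)
  have \<Lambda>: "1 / (2 * cluster_const) > 0" "1 \<in> {1 / (2 * cluster_const)..2}"
    "1 / (2 * cluster_const) \<le> 2"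
    using cluster_const_ge_1 by (auto simp: divide_le_eq)
  have law: "\<exists>lam\<in>{1 / (2 * cluster_const)..2}. \<forall>t>0.
      dev n A lam t \<le> C * measure P (cylinder (cube n) A) powr \<rho> * exp (- b * t)"
    if A: "A \<in> patterns (cube n)" for n A
  proof (cases "measure P (cylinder (cube n) A) \<le> p0")
    case True
    have "Cr * measure P (cylinder (cube n) A) powr \<rho> * exp (- \<theta> * t)
        \<le> C * measure P (cylinder (cube n) A) powr \<rho> * exp (- b * t)" if "t > 0" for t
      using that Cr by (intro mult_mono mult_right_mono) (auto simp: C_def b_def)
    then show ?thesis using rare[OF A True] by (meson order_trans)
  next
    case False
    have "Cf * exp (- c * t) \<le> C * measure P (cylinder (cube n) A) powr \<rho> * exp (- b * t)" if "t > 0" for t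
    proof (rule mult_mono)
      have "Cf = Cf / p0 powr \<rho> * p0 powr \<rho>" using Cr by simp
      also have "\<dots> \<le> C * measure P (cylinder (cube n) A) powr \<rho>"
        using False Cr Cf \<rho> by (intro mult_mono powr_mono2) (auto simp: C_def)
      finally show "Cf \<le> C * measure P (cylinder (cube n) A) powr \<rho>" .
    qed (use that C in \<open>auto simp: b_def\<close>)
    then show ?thesis using frequent[OF A] False \<Lambda>(2) by (meson less_imp_le not_le order_trans)
  qed
  show ?thesis
    using C b \<rho> \<Lambda> law unfolding dev_def
    by (intro exI[of _ C] conjI[OF C] exI[of _ b] conjI[OF b] exI[of _ \<rho>] conjI[OF \<rho>]
        exI[of _ "1 / (2 * cluster_const)"] conjI[OF \<Lambda>(1)] exI[of _ "2 :: real"]) auto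
qed

theorem theorem1:
  fixes U :: "(int ^ 'd::finite) set \<Rightarrow> ('d, 'a::finite) config \<Rightarrow> real"
    and P :: "('d, 'a) config measure"
  assumes dim: "CARD('d) \<ge> 2"
    and interaction: "ti_interaction U"
    and gibbs: "ti_gibbs_field U P"
    and mixing: "exp_phi_mixing P"
  shows "\<exists>C>0. \<exists>c>0. \<exists>\<rho>>0. \<exists>\<Lambda>1>0. \<exists>\<Lambda>2>0. \<Lambda>1 \<le> \<Lambda>2 \<and>
    (\<forall>n. \<forall>A\<in>patterns (cube n). \<exists>lam\<in>{\<Lambda>1..\<Lambda>2}. \<forall>t>0.
       \<bar>measure P {\<sigma>. ereal_of_enat (first_occurrence n A \<sigma>) >
            ereal ((t / (lam * measure P (cylinder (cube n) A))) powr (1 / real CARD('d)))}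
          - exp (- t)\<bar>
       \<le> C * measure P (cylinder (cube n) A) powr \<rho> * exp (- c * t))"
proof (cases "CARD('a) = 1")
  case True
  have rf: "ti_random_field P" using gibbs by (simp add: ti_gibbs_field_def)
  interpret prob_space P by (rule ti_random_field_facts(1)[OF rf])
  have sp: "space P = UNIV" by (rule ti_random_field_facts(3)[OF rf])
  obtain a where "(UNIV :: 'a set) = {a}" using True by (auto simp: card_1_singleton_iff)
  then have single: "u = v" for u v :: 'a by (metis UNIV_I singletonD)
  \<comment> \<open>Here p = 1 and the time is constantly 1. For t \<ge> 1 the probability is 0 and
    the deviation is exp (- t); for t < 1 it is at most 1, hence at most exp (1 - t), which explains
    the constant exp 1.\<close>
  have bound: "\<bar>measure P {\<sigma>. ereal_of_enat (first_occurrence n A \<sigma>) >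
            ereal ((t / (1 * measure P (cylinder (cube n) A))) powr (1 / real CARD('d)))}
          - exp (- t)\<bar> \<le> exp 1 * measure P (cylinder (cube n) A) powr 1 * exp (- 1 * t)"
    if A: "A \<in> patterns (cube n)" and t: "t > 0" for n A and t :: real
  proof -
    have "cylinder (cube n) A = UNIV"
      unfolding cylinder_def using single by (auto simp: fun_eq_iff)
    then have cyl: "measure P (cylinder (cube n) A) = 1" using prob_space sp by simp
    have fo: "ereal_of_enat (first_occurrence n A \<sigma>) = ereal 1" for \<sigma>
      using first_occurrence_singleton_alphabet[OF True A] by (simp add: one_enat_def)
    show ?thesis
    proof (cases "t \<ge> 1")
      case True
      then have "t powr (1 / real CARD('d)) \<ge> 1" by (intro ge_one_powr_ge_zero) auto
      then show ?thesis by (simp add: cyl fo)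
    next
      case False
      then have "t powr (1 / real CARD('d)) < 1 powr (1 / real CARD('d))"
        using t by (intro powr_less_mono2) auto
      then have "measure P {\<sigma>. ereal_of_enat (first_occurrence n A \<sigma>) >
            ereal ((t / (1 * measure P (cylinder (cube n) A))) powr (1 / real CARD('d)))} = 1"
        using prob_space sp by (simp add: cyl fo)
      moreover have "\<bar>1 - exp (- t)\<bar> \<le> exp 1 * exp (- t)"
      proof -
        have "1 \<le> exp 1 * exp (- t)" using False by (simp add: exp_add[symmetric])
        moreover have "\<bar>1 - exp (- t)\<bar> \<le> 1" using t by simp
        ultimately show ?thesis by linarith
      qed
      ultimately show ?thesis by (simp only: cyl) simp
    qed
  qed
  show ?thesis
    by (rule exI[of _ "exp 1"], rule conjI, simp, rule exI[of _ 1], rule conjI, simp,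
        rule exI[of _ 1], rule conjI, simp, rule exI[of _ 1], rule conjI, simp,
        rule exI[of _ 1], rule conjI, simp, rule conjI, simp)
      (intro allI ballI bexI[of _ 1] impI bound; simp)
next
  case False
  have "CARD('a) \<noteq> 0" by simp
  with False have card: "CARD('a) \<ge> 2" by linarith
  have rf: "ti_random_field P" using gibbs by (simp add: ti_gibbs_field_def)
  obtain C1 C2 where C: "C1 > 0" "C2 > 0"
    and mix: "\<And>S T m (E :: ('d, 'a) config set) F. \<lbrakk>finite S; finite T; S \<noteq> {}; m > 0;
       \<And>x y. x \<in> S \<Longrightarrow> y \<in> T \<Longrightarrow> m \<le> real_of_int (l1 (x - y));
       E \<in> sets (coord_algebra S); F \<in> sets (coord_algebra T)\<rbrakk> \<Longrightarrow>
       \<bar>measure P (E \<inter> F) - measure P E * measure P F\<bar> \<le> real (card S) * (C1 * exp (- C2 * m)) * measure P F"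
    using exp_phi_mixing_bound[OF rf mixing] by blast
  obtain \<gamma> where \<gamma>: "0 < \<gamma>" "\<gamma> < 1"
    and energy: "\<And>V (E :: ('d, 'a) config set) \<eta>. finite V \<Longrightarrow> E \<in> sets (coord_algebra (- V)) \<Longrightarrow>
       measure P (E \<inter> {\<sigma>. \<forall>x\<in>V. \<sigma> x = \<eta> x}) \<le> \<gamma> ^ card V * measure P E"
    and pos: "\<And>V (\<eta> :: ('d, 'a) config). finite V \<Longrightarrow> 0 < measure P {\<sigma>. \<forall>x\<in>V. \<sigma> x = \<eta> x}"
    using finite_volume_energy[OF interaction gibbs card] by blast
  interpret mixing_field P C1 C2 \<gamma>
    by unfold_locales (use rf C \<gamma> mix energy pos in auto)
  show ?thesis by (rule exponential_law)
qed

end
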